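(* Let $\hat g=C_n^{(1)}$ or $\hat g=D_n^{(1)}$, let $p\in\{0,1,\dots,n\}$ and $N\ge1$. Then the transfer matrix has the duality symmetry $$\mathcal U\,t(u,p)\,\mathcal U=f(u,p)\,t(u,n-p),$$ where $\mathcal U=U_1U_2\cdots U_N$ (so $\mathcal U^2=\mathbb I^{\otimes N}$), $U=\begin{pmatrix}0&\mathbb I_{n\times n}\\ \mathbb I_{n\times n}&0\end{pmatrix}$, and $f(u,p)=f^L(u,p)f^R(u,p)$ with $$f^R(u,p)=\frac{\gamma_0e^u+e^{(2n-4p)\eta}}{\gamma_0+e^{u+(2n-4p)\eta}},\qquad f^L(u,p)=\frac{\gamma_0e^u+e^{(4p+2n\pm4)\eta}}{\gamma_0e^{(4n\pm4)\eta}+e^{u+(4p-2n)\eta}},$$ the upper sign being for $C_n^{(1)}$ and the lower sign for $D_n^{(1)}$.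
   Context: **R-matrix.** Fix $n\ge1$, $\eta\in\mathbb C$, $d=2n$, $\mathcal V=\mathbb C^{2n}$, $e_{ij}$ the elementary $2n\times2n$ matrices, $\mathbb I$ the identity on $\mathcal V$. Let $\kappa=2n+2$ for $C_n^{(1)}$, $\kappa=2n-2$ for $D_n^{(1)}$; $\alpha'=2n+1-\alpha$. For $C_n^{(1)}$: $\epsilon_\alpha=1,\bar\alpha=\alpha-\frac12$ if $\alpha\le n$; $\epsilon_\alpha=-1,\bar\alpha=\alpha+\frac12$ if $\alpha\ge n+1$. For $D_n^{(1)}$: $\epsilon_\alpha=1$; $\bar\alpha=\alpha+\frac12$ if $\alpha\le n$, $\bar\alpha=\alpha-\frac12$ if $\alpha\ge n+1$. Let $$c(u)=2\sinh(\tfrac u2-2\eta)\sinh(\tfrac u2-\kappa\eta),\ b(u)=2\sinh(\tfrac u2)\sinh(\tfrac u2-\kappa\eta),\ e(u)=-2e^{-u/2}\sinh(2\eta)\sinh(\tfrac u2-\kappa\eta),\ \bar e(u)=e^ue(u),$$ and $a_{\alpha\alpha}(u)=2\sinh(\frac u2)\sinh(\frac u2-(\kappa-2)\eta)$, and, with upper signs for $\alpha<\beta$ and lower signs for $\alpha>\beta$, $a_{\alpha\beta}(u)=2\sinh(2\eta)e^{\mp u/2}[\epsilon_\alpha\epsilon_\beta e^{(\pm\kappa+2(\bar\alpha-\bar\beta))\eta}\sinh(\frac u2)-\delta_{\alpha\beta'}\sinh(\frac u2-\kappa\eta)]$. Then $$R(u)=c(u)\sum_{\alpha}e_{\alpha\alpha}\otimes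 e_{\alpha\alpha}+b(u)\sum_{\alpha\neq\beta,\beta'}e_{\alpha\alpha}\otimes e_{\beta\beta}+\Big(e(u)\sum_{\alpha<\beta,\alpha\ne\beta'}+\bar e(u)\sum_{\alpha>\beta,\alpha\ne\beta'}\Big)e_{\alpha\beta}\otimes e_{\beta\alpha}+\sum_{\alpha,\beta}a_{\alpha\beta}(u)e_{\alpha\beta}\otimes e_{\alpha'\beta'}.$$ Subscripts on operators indicate the tensor factors on which they act; $R_{21}=\mathcal PR_{12}\mathcal P$ with $\mathcal P$ the permutation. **K-matrices.** $\rho=-2\kappa\eta$. Fix $\gamma_0\in\{1,-1\}$ (the same for $t(u,p)$ and $t(u,n-p)$); $\gamma=\gamma_0e^{(4p+2)\eta+\rho/2}$ for $C_n^{(1)}$, $\gamma=\gamma_0e^{(4p-2)\eta+\rho/2}$ for $D_n^{(1)}$. $K^R(u,p)$ is diagonal with first $p$ entries $e^{-u}$, middle $2n-2p$ entries $\frac{\gamma e^u+1}{\gamma+e^u}$, last $p$ entries $e^u$. $M=\varsigma\sum_\alpha e^{4(\frac{2n+1}2-\bar\alpha)\eta}e_{\alpha\alpha}$ with $\varsigma=-1$ for $C_n^{(1)}$, $\varsigma=1$ for $D_n^{(1)}$; $K^L(u,p)=K^R(-u-\rho,p)M$. Identities in $u$ are understood as identities of meromorphic functions. **Transfer matrix** (on $\mathcal V^{\otimes N}$, $a$ an auxiliary copy of $\mathcal V$): $t(u,p)=\operatorname{tr}_aK^L_a(u,p)T_a(u)K^R_a(u,p)\widehat T_a(u)$, $T_a(u)=R_{aN}(u)\cdots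 R_{a1}(u)$, $\widehat T_a(u)=R_{1a}(u)\cdots R_{Na}(u)$. *)

theory Defs
  imports Complex_Main "HOL-Analysis.Sparse_In" "Jordan_Normal_Form.Matrix"
begin

section \<open>Operators on tensor powers\<close>

text \<open>
  The standard basis of the \<open>m\<close>-fold tensor power of a \<open>d\<close>-dimensional space is numbered
  \<open>0, \<dots>, d ^ m - 1\<close> lexicographically, the leftmost tensor factor being the most significant
  base-\<open>d\<close> digit. This agrees with the numbering used by the Kronecker product below.
  The tensor factors themselves are numbered \<open>0, \<dots>, m - 1\<close> from left to right.
\<close>

definition kron :: "complex mat \<Rightarrow> complex mat \<Rightarrow> complex mat" where
  "kron A B = mat (dim_row A * dim_row B) (dim_col A * dim_col B)
     (\<lambda>(i, j). A $$ (i div dim_row B, j div dim_col B) * B $$ (i mod dim_row B, j mod dim_col B))"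

definition digit :: "nat \<Rightarrow> nat \<Rightarrow> nat \<Rightarrow> nat \<Rightarrow> nat" where
  "digit d m k x = x div d ^ (m - 1 - k) mod d"

text \<open>The operator \<open>A\<^sub>k\<close>: \<open>A\<close> acting on the tensor factor \<open>k\<close>.\<close>

definition op1 :: "nat \<Rightarrow> nat \<Rightarrow> nat \<Rightarrow> complex mat \<Rightarrow> complex mat" where
  "op1 d m k A = mat (d ^ m) (d ^ m) (\<lambda>(x, y).
     if \<forall>r<m. r \<noteq> k \<longrightarrow> digit d m r x = digit d m r y
     then A $$ (digit d m k x, digit d m k y) else 0)"

text \<open>
  The operator \<open>A\<^sub>k\<^sub>l\<close> for \<open>k \<noteq> l\<close>: the first tensor factor of \<open>A\<close> acts on the factor \<open>k\<close> and
  the second one on the factor \<open>l\<close>, in whichever order \<open>k\<close> and \<open>l\<close> come; so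
  \<open>A\<^sub>l\<^sub>k\<close> is the conjugate of \<open>A\<^sub>k\<^sub>l\<close> by the permutation of the two factors.
\<close>

definition op2 :: "nat \<Rightarrow> nat \<Rightarrow> nat \<Rightarrow> nat \<Rightarrow> complex mat \<Rightarrow> complex mat" where
  "op2 d m k l A = mat (d ^ m) (d ^ m) (\<lambda>(x, y).
     if \<forall>r<m. r \<noteq> k \<and> r \<noteq> l \<longrightarrow> digit d m r x = digit d m r y
     then A $$ (digit d m k x * d + digit d m l x, digit d m k y * d + digit d m l y) else 0)"

text \<open>Partial trace over the leftmost tensor factor.\<close>

definition ptrace :: "nat \<Rightarrow> nat \<Rightarrow> complex mat \<Rightarrow> complex mat" where
  "ptrace d N A = mat (d ^ N) (d ^ N)
     (\<lambda>(x, y). \<Sum>k<d. A $$ (k * d ^ N + x, k * d ^ N + y))"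

definition mat_prod :: "nat \<Rightarrow> complex mat list \<Rightarrow> complex mat" where
  "mat_prod D As = foldr (*) As (1\<^sub>m D)"


section \<open>The R-matrix\<close>

datatype affine_type = C_affine | D_affine

text \<open>
  The indices \<open>\<alpha>\<close>, \<open>\<beta>\<close> range over \<open>{1..2 * n}\<close>; the row and column numbers of matrices start
  at \<open>0\<close>, whence the shift in \<open>elem_mat\<close>.
\<close>

definition elem_mat :: "nat \<Rightarrow> nat \<Rightarrow> nat \<Rightarrow> complex mat" where
  "elem_mat n \<alpha> \<beta> = mat (2 * n) (2 * n) (\<lambda>(i, j). if i + 1 = \<alpha> \<and> j + 1 = \<beta> then 1 else 0)"

text \<open>The upper sign for \<open>C_affine\<close>, the lower sign for \<open>D_affine\<close>.\<close>

definition pm :: "affine_type \<Rightarrow> complex" where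
  "pm g = (case g of C_affine \<Rightarrow> 1 | D_affine \<Rightarrow> - 1)"

definition kappa :: "affine_type \<Rightarrow> nat \<Rightarrow> complex" where
  "kappa g n = (case g of C_affine \<Rightarrow> 2 * of_nat n + 2 | D_affine \<Rightarrow> 2 * of_nat n - 2)"

definition prime_index :: "nat \<Rightarrow> nat \<Rightarrow> nat" where
  "prime_index n \<alpha> = 2 * n + 1 - \<alpha>"

definition eps :: "affine_type \<Rightarrow> nat \<Rightarrow> nat \<Rightarrow> complex" where
  "eps g n \<alpha> = (case g of C_affine \<Rightarrow> (if \<alpha> \<le> n then 1 else - 1) | D_affine \<Rightarrow> 1)"

definition bar :: "affine_type \<Rightarrow> nat \<Rightarrow> nat \<Rightarrow> complex" where
  "bar g n \<alpha> = (case g of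
     C_affine \<Rightarrow> (if \<alpha> \<le> n then of_nat \<alpha> - 1 / 2 else of_nat \<alpha> + 1 / 2)
   | D_affine \<Rightarrow> (if \<alpha> \<le> n then of_nat \<alpha> + 1 / 2 else of_nat \<alpha> - 1 / 2))"

definition R_c :: "affine_type \<Rightarrow> nat \<Rightarrow> complex \<Rightarrow> complex \<Rightarrow> complex" where
  "R_c g n \<eta> u = 2 * sinh (u / 2 - 2 * \<eta>) * sinh (u / 2 - kappa g n * \<eta>)"

definition R_b :: "affine_type \<Rightarrow> nat \<Rightarrow> complex \<Rightarrow> complex \<Rightarrow> complex" where
  "R_b g n \<eta> u = 2 * sinh (u / 2) * sinh (u / 2 - kappa g n * \<eta>)"

definition R_e :: "affine_type \<Rightarrow> nat \<Rightarrow> complex \<Rightarrow> complex \<Rightarrow> complex" where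
  "R_e g n \<eta> u = - 2 * exp (- u / 2) * sinh (2 * \<eta>) * sinh (u / 2 - kappa g n * \<eta>)"

definition R_ebar :: "affine_type \<Rightarrow> nat \<Rightarrow> complex \<Rightarrow> complex \<Rightarrow> complex" where
  "R_ebar g n \<eta> u = exp u * R_e g n \<eta> u"

definition R_a :: "affine_type \<Rightarrow> nat \<Rightarrow> complex \<Rightarrow> nat \<Rightarrow> nat \<Rightarrow> complex \<Rightarrow> complex" where
  "R_a g n \<eta> \<alpha> \<beta> u =
     (if \<alpha> = \<beta> then 2 * sinh (u / 2) * sinh (u / 2 - (kappa g n - 2) * \<eta>)
      else let s = (if \<alpha> < \<beta> then 1 else - 1) in
        2 * sinh (2 * \<eta>) * exp (- s * u / 2) *
          (eps g n \<alpha> * eps g n \<beta> * exp ((s * kappa g n + 2 * (bar g n \<alpha> - bar g n \<beta>)) * \<eta>) * sinh (u / 2)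
           - (if \<alpha> = prime_index n \<beta> then 1 else 0) * sinh (u / 2 - kappa g n * \<eta>)))"

text \<open>The sum of elementary tensors is taken entry by entry.\<close>

definition R_mat :: "affine_type \<Rightarrow> nat \<Rightarrow> complex \<Rightarrow> complex \<Rightarrow> complex mat" where
  "R_mat g n \<eta> u = mat ((2 * n) * (2 * n)) ((2 * n) * (2 * n)) (\<lambda>ij.
     let I = {1..2 * n}; EE = (\<lambda>\<alpha> \<beta> \<gamma> \<delta>. kron (elem_mat n \<alpha> \<beta>) (elem_mat n \<gamma> \<delta>) $$ ij) in
       R_c g n \<eta> u * (\<Sum>\<alpha>\<in>I. EE \<alpha> \<alpha> \<alpha> \<alpha>)
     + R_b g n \<eta> u *
         (\<Sum>(\<alpha>, \<beta>)\<in>{(\<alpha>, \<beta>)\<in>I \<times> I. \<alpha> \<noteq> \<beta> \<and> \<alpha> \<noteq> prime_index n \<beta>}. EE \<alpha> \<alpha> \<beta> \<beta>)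
     + R_e g n \<eta> u *
         (\<Sum>(\<alpha>, \<beta>)\<in>{(\<alpha>, \<beta>)\<in>I \<times> I. \<alpha> < \<beta> \<and> \<alpha> \<noteq> prime_index n \<beta>}. EE \<alpha> \<beta> \<beta> \<alpha>)
     + R_ebar g n \<eta> u *
         (\<Sum>(\<alpha>, \<beta>)\<in>{(\<alpha>, \<beta>)\<in>I \<times> I. \<alpha> > \<beta> \<and> \<alpha> \<noteq> prime_index n \<beta>}. EE \<alpha> \<beta> \<beta> \<alpha>)
     + (\<Sum>(\<alpha>, \<beta>)\<in>I \<times> I.
          R_a g n \<eta> \<alpha> \<beta> u * EE \<alpha> \<beta> (prime_index n \<alpha>) (prime_index n \<beta>)))"


section \<open>The K-matrices\<close>

definition rho :: "affine_type \<Rightarrow> nat \<Rightarrow> complex \<Rightarrow> complex" where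
  "rho g n \<eta> = - 2 * kappa g n * \<eta>"

definition gam :: "affine_type \<Rightarrow> nat \<Rightarrow> complex \<Rightarrow> complex \<Rightarrow> nat \<Rightarrow> complex" where
  "gam g n \<eta> \<gamma>\<^sub>0 p = (case g of
     C_affine \<Rightarrow> \<gamma>\<^sub>0 * exp ((4 * of_nat p + 2) * \<eta> + rho g n \<eta> / 2)
   | D_affine \<Rightarrow> \<gamma>\<^sub>0 * exp ((4 * of_nat p - 2) * \<eta> + rho g n \<eta> / 2))"

definition K_R :: "affine_type \<Rightarrow> nat \<Rightarrow> complex \<Rightarrow> complex \<Rightarrow> complex \<Rightarrow> nat \<Rightarrow> complex mat" where
  "K_R g n \<eta> \<gamma>\<^sub>0 u p = (let \<gamma> = gam g n \<eta> \<gamma>\<^sub>0 p in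
     mat_diag (2 * n) (\<lambda>i.
       if i < p then exp (- u)
       else if i < 2 * n - p then (\<gamma> * exp u + 1) / (\<gamma> + exp u)
       else exp u))"

definition M_mat :: "affine_type \<Rightarrow> nat \<Rightarrow> complex \<Rightarrow> complex mat" where
  "M_mat g n \<eta> = (case g of C_affine \<Rightarrow> - 1 | D_affine \<Rightarrow> 1) \<cdot>\<^sub>m
     mat_diag (2 * n) (\<lambda>i. exp (4 * ((2 * of_nat n + 1) / 2 - bar g n (i + 1)) * \<eta>))"

definition K_L :: "affine_type \<Rightarrow> nat \<Rightarrow> complex \<Rightarrow> complex \<Rightarrow> complex \<Rightarrow> nat \<Rightarrow> complex mat" where
  "K_L g n \<eta> \<gamma>\<^sub>0 u p = K_R g n \<eta> \<gamma>\<^sub>0 (- u - rho g n \<eta>) p * M_mat g n \<eta>"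


section \<open>The transfer matrix\<close>

text \<open>
  On the \<open>N + 1\<close> tensor factors, the auxiliary space is factor \<open>0\<close> and the \<open>j\<close>-th quantum space
  is factor \<open>j\<close>, for \<open>1 \<le> j \<le> N\<close>.
\<close>

definition T_mono :: "affine_type \<Rightarrow> nat \<Rightarrow> nat \<Rightarrow> complex \<Rightarrow> complex \<Rightarrow> complex mat" where
  "T_mono g n N \<eta> u =
     mat_prod ((2 * n) ^ (N + 1)) (map (\<lambda>j. op2 (2 * n) (N + 1) 0 j (R_mat g n \<eta> u)) (rev [1..<N + 1]))"

definition T_hat :: "affine_type \<Rightarrow> nat \<Rightarrow> nat \<Rightarrow> complex \<Rightarrow> complex \<Rightarrow> complex mat" where
  "T_hat g n N \<eta> u =
     mat_prod ((2 * n) ^ (N + 1)) (map (\<lambda>j. op2 (2 * n) (N + 1) j 0 (R_mat g n \<eta> u)) [1..<N + 1])"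

definition transfer ::
  "affine_type \<Rightarrow> nat \<Rightarrow> nat \<Rightarrow> complex \<Rightarrow> complex \<Rightarrow> complex \<Rightarrow> nat \<Rightarrow> complex mat" where
  "transfer g n N \<eta> \<gamma>\<^sub>0 u p = ptrace (2 * n) N
     (op1 (2 * n) (N + 1) 0 (K_L g n \<eta> \<gamma>\<^sub>0 u p) * T_mono g n N \<eta> u *
      op1 (2 * n) (N + 1) 0 (K_R g n \<eta> \<gamma>\<^sub>0 u p) * T_hat g n N \<eta> u)"


section \<open>The duality transformation\<close>

definition U_mat :: "nat \<Rightarrow> complex mat" where
  "U_mat n = four_block_mat (0\<^sub>m n n) (1\<^sub>m n) (1\<^sub>m n) (0\<^sub>m n n)"

text \<open>There is no auxiliary space here, so the \<open>j\<close>-th quantum space is factor \<open>j - 1\<close>.\<close>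

definition U_all :: "nat \<Rightarrow> nat \<Rightarrow> complex mat" where
  "U_all n N = mat_prod ((2 * n) ^ N) (map (\<lambda>j. op1 (2 * n) N (j - 1) (U_mat n)) [1..<N + 1])"

definition f_R :: "nat \<Rightarrow> complex \<Rightarrow> complex \<Rightarrow> complex \<Rightarrow> nat \<Rightarrow> complex" where
  "f_R n \<eta> \<gamma>\<^sub>0 u p =
     (\<gamma>\<^sub>0 * exp u + exp ((2 * of_nat n - 4 * of_nat p) * \<eta>)) /
     (\<gamma>\<^sub>0 + exp (u + (2 * of_nat n - 4 * of_nat p) * \<eta>))"

definition f_L :: "affine_type \<Rightarrow> nat \<Rightarrow> complex \<Rightarrow> complex \<Rightarrow> complex \<Rightarrow> nat \<Rightarrow> complex" where
  "f_L g n \<eta> \<gamma>\<^sub>0 u p =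
     (\<gamma>\<^sub>0 * exp u + exp ((4 * of_nat p + 2 * of_nat n + pm g * 4) * \<eta>)) /
     (\<gamma>\<^sub>0 * exp ((4 * of_nat n + pm g * 4) * \<eta>) + exp (u + (4 * of_nat p - 2 * of_nat n) * \<eta>))"

definition f_dual :: "affine_type \<Rightarrow> nat \<Rightarrow> complex \<Rightarrow> complex \<Rightarrow> complex \<Rightarrow> nat \<Rightarrow> complex" where
  "f_dual g n \<eta> \<gamma>\<^sub>0 u p = f_L g n \<eta> \<gamma>\<^sub>0 u p * f_R n \<eta> \<gamma>\<^sub>0 u p"

end

theory Submission
  imports Defs "HOL-Analysis.Complex_Transcendental"
begin

text \<open>
  Let \<open>\<sigma>\<close> be the permutation of the basis given by \<open>U\<close>, and let \<open>G(u)\<close> be diagonal with first \<open>n\<close>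
  entries \<open>e\<^sup>u\<^sup>/\<^sup>2\<close> and last \<open>n\<close> entries \<open>e\<^sup>-\<^sup>u\<^sup>/\<^sup>2\<close>. As \<open>\<sigma>\<close> commutes with \<open>\<alpha> \<mapsto> \<alpha>'\<close> and exchanges
  \<open>\<alpha> < \<beta>\<close> with \<open>\<alpha> > \<beta>\<close> exactly for indices in different halves, conjugating \<open>R(u)\<close> by \<open>U \<otimes> U\<close>
  amounts to conjugating it by \<open>G\<close> in the first factor, or by the inverse of \<open>G\<close> in the second.
  Hence conjugating by \<open>U\<close> on all factors turns \<open>T\<close> into \<open>G T G\<^sup>-\<^sup>1\<close> and \<open>T_hat\<close> into
  \<open>G\<^sup>-\<^sup>1 T_hat G\<close>, with \<open>G\<close> in the auxiliary space. Under the trace the factors \<open>G\<close> are absorbed by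
  the K-matrices: \<open>G\<^sup>-\<^sup>1 U K\<^sup>R(u,p) U G\<^sup>-\<^sup>1 = f\<^sup>R(u,p) K\<^sup>R(u,n-p)\<close>, because the parameters \<open>\<gamma>\<close> of \<open>p\<close> and
  \<open>n - p\<close> are inverse to each other. Conjugating \<open>M\<close> by \<open>U\<close> multiplies it by
  \<open>e\<^sup>\<plusminus>\<^sup>\<rho>\<close>, which reduces the left K-matrix to the right one at \<open>-u-\<rho>\<close>.
\<close>

(* keeps (2 * n) ^ m from being split into 2 ^ m * n ^ m *)
declare power_mult_distrib [where a = "numeral w" for w, simp del]

section \<open>Digits\<close>

lemma digit_less: "d > 0 \<Longrightarrow> digit d m k x < d"
  by (simp add: digit_def)

text \<open>Digits are counted from the most significant end, so dividing by \<open>d\<close> drops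
  the last digit without renumbering the others. Inductions on \<open>m\<close> therefore peel off
  the last tensor factor.\<close>

lemma digit_Suc: "k < m \<Longrightarrow> digit d (Suc m) k x = digit d m k (x div d)"
proof -
  assume "k < m"
  then have "m - k = Suc (m - 1 - k)" by simp
  then have "d ^ (Suc m - 1 - k) = d * d ^ (m - 1 - k)"
    by simp
  then show ?thesis
    by (simp add: digit_def div_mult2_eq)
qed

lemma digit_last: "digit d (Suc m) m x = x mod d"
  by (simp add: digit_def)

lemma digits_eqI:
  assumes "x < d ^ m" "y < d ^ m" "\<And>k. k < m \<Longrightarrow> digit d m k x = digit d m k y"
  shows "x = y"
  using assms
proof (induction m arbitrary: x y)
  case (Suc m)
  have "x div d = y div d"
  proof (rule Suc.IH)
    show "x div d < d ^ m" "y div d < d ^ m"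
      using Suc.prems(1,2) by (simp_all add: less_mult_imp_div_less mult.commute)
    show "digit d m k (x div d) = digit d m k (y div d)" if "k < m" for k
      using Suc.prems(3)[of k] that by (simp add: digit_Suc)
  qed
  moreover have "x mod d = y mod d"
    using Suc.prems(3)[of m] by (simp add: digit_last)
  ultimately show ?case
    by (metis div_mult_mod_eq)
qed simp

lemma mult_add_less_mult: "k * D + x < d * D" if "k < d" "x < D" for k d x D :: nat
proof -
  have "Suc k * D \<le> d * D" using that by (intro mult_right_mono) simp_all
  with that show ?thesis by simp
qed

text \<open>Horner scheme with \<open>f 0\<close> as the most significant digit, used to define an
  index by prescribing its digits.\<close>

fun undigit :: "nat \<Rightarrow> nat \<Rightarrow> (nat \<Rightarrow> nat) \<Rightarrow> nat" where
  "undigit d 0 f = 0"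
| "undigit d (Suc m) f = undigit d m f * d + f m"

lemma undigit_less: "(\<And>k. k < m \<Longrightarrow> f k < d) \<Longrightarrow> undigit d m f < d ^ m"
proof (induction m)
  case (Suc m)
  then have "undigit d m f * d + f m < d ^ m * d" by (intro mult_add_less_mult) simp_all
  then show ?case by (simp add: mult.commute)
qed simp

lemma digit_undigit:
  "(\<And>k. k < m \<Longrightarrow> f k < d) \<Longrightarrow> k < m \<Longrightarrow> digit d m k (undigit d m f) = f k"
proof (induction m)
  case (Suc m)
  have "f m < d" using Suc.prems(1) by simp
  show ?case
  proof (cases "k = m")
    case True
    with \<open>f m < d\<close> show ?thesis by (simp add: digit_last)
  next
    case False
    then have "k < m" using Suc.prems(2) by simp
    moreover have "(undigit d m f * d + f m) div d = undigit d m f" using \<open>f m < d\<close> by simp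
    ultimately show ?thesis using Suc.IH Suc.prems(1) by (simp add: digit_Suc)
  qed
qed simp

section \<open>Splitting off the leading (auxiliary) digit\<close>

lemma digit_0_add: "x < d ^ N \<Longrightarrow> k < d \<Longrightarrow> digit d (Suc N) 0 (k * d ^ N + x) = k"
  by (simp add: digit_def)

lemma digit_Suc_add:
  assumes "r < N" "d > 0"
  shows "digit d (Suc N) (Suc r) (k * d ^ N + x) = digit d N r x"
proof -
  \<comment> \<open>\<open>d ^ N\<close> contains \<open>Suc r\<close> more factors \<open>d\<close>
    than the divisor \<open>d ^ (N - 1 - r)\<close>, so the leading digit adds a multiple of
    \<open>d\<close> to the quotient and vanishes modulo \<open>d\<close>.\<close>
  have "N = Suc r + (N - 1 - r)" using assms by simp
  then have "d ^ N = d ^ Suc r * d ^ (N - 1 - r)" by (metis power_add)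
  then have eq: "k * d ^ N + x = x + (k * d ^ r * d) * d ^ (N - 1 - r)" by simp
  have "(x + (k * d ^ r * d) * d ^ (N - 1 - r)) div d ^ (N - 1 - r)
    = k * d ^ r * d + x div d ^ (N - 1 - r)"
    using assms by (subst div_mult_self1) simp_all
  then have "(k * d ^ N + x) div d ^ (N - 1 - r) mod d = x div d ^ (N - 1 - r) mod d"
    unfolding eq by simp
  then show ?thesis
    by (simp add: digit_def)
qed

section \<open>The index permutation\<close>

text \<open>This is \<sigma> on indices counted from 0, whereas \<open>R_a\<close>,
  \<open>eps\<close> and \<open>bar\<close> take indices counted from 1; hence the arguments
  \<open>half_swap n a + 1\<close> below.\<close>

definition half_swap :: "nat \<Rightarrow> nat \<Rightarrow> nat" where
  "half_swap n a = (if a < n then a + n else a - n)"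

lemma half_swap_less: "a < 2 * n \<Longrightarrow> half_swap n a < 2 * n"
  by (auto simp: half_swap_def)

lemma half_swap_half_swap: "a < 2 * n \<Longrightarrow> half_swap n (half_swap n a) = a"
  by (auto simp: half_swap_def)

text \<open>A variable set \<open>S\<close> of sites covers both a single factor,
  \<open>S = {k}\<close>, and the full permutation, \<open>S = {..<m}\<close>, and lets the latter
  be assembled one site at a time.\<close>

definition swap_sites :: "nat \<Rightarrow> nat \<Rightarrow> nat set \<Rightarrow> nat \<Rightarrow> nat" where
  "swap_sites n m S x = undigit (2 * n) m
     (\<lambda>k. if k \<in> S then half_swap n (digit (2 * n) m k x) else digit (2 * n) m k x)"

context
  fixes n :: nat
  assumes n: "n \<ge> 1"
begin

lemma swap_sites_less: "swap_sites n m S x < (2 * n) ^ m"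
  unfolding swap_sites_def using n
  by (intro undigit_less) (simp add: half_swap_less digit_less)

lemma digit_swap_sites:
  "k < m \<Longrightarrow> digit (2 * n) m k (swap_sites n m S x) =
     (if k \<in> S then half_swap n (digit (2 * n) m k x) else digit (2 * n) m k x)"
  unfolding swap_sites_def using n
  by (subst digit_undigit) (simp_all add: half_swap_less digit_less)

lemma swap_sites_swap_sites: "x < (2 * n) ^ m \<Longrightarrow> swap_sites n m S (swap_sites n m S x) = x"
  using n
  by - (rule digits_eqI[of _ "2 * n" m],
    simp_all add: swap_sites_less digit_swap_sites half_swap_half_swap digit_less)

lemma swap_sites_empty: "x < (2 * n) ^ m \<Longrightarrow> swap_sites n m {} x = x"
  by (rule digits_eqI[of _ "2 * n" m]) (simp_all add: swap_sites_less digit_swap_sites)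

lemma swap_sites_insert:
  "k \<notin> S \<Longrightarrow> swap_sites n m {k} (swap_sites n m S x) = swap_sites n m (insert k S) x"
  by (rule digits_eqI[of _ "2 * n" m]) (auto simp: swap_sites_less digit_swap_sites)

text \<open>Compatibility with the splitting into auxiliary and quantum spaces, in the form that
  carries the permutation through the partial trace.\<close>

lemma swap_sites_Suc:
  assumes "x < (2 * n) ^ N" "k < 2 * n"
  shows "swap_sites n (Suc N) {..<Suc N} (k * (2 * n) ^ N + x) =
    half_swap n k * (2 * n) ^ N + swap_sites n N {..<N} x"
proof (rule digits_eqI[of _ "2 * n" "Suc N"])
  show "swap_sites n (Suc N) {..<Suc N} (k * (2 * n) ^ N + x) < (2 * n) ^ Suc N"
    by (rule swap_sites_less)
  show "half_swap n k * (2 * n) ^ N + swap_sites n N {..<N} x < (2 * n) ^ Suc N"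
    using mult_add_less_mult[OF half_swap_less[OF assms(2)] swap_sites_less] by simp
  fix r assume r: "r < Suc N"
  show "digit (2 * n) (Suc N) r (swap_sites n (Suc N) {..<Suc N} (k * (2 * n) ^ N + x)) =
    digit (2 * n) (Suc N) r (half_swap n k * (2 * n) ^ N + swap_sites n N {..<N} x)"
  proof (cases r)
    case 0
    then show ?thesis
      using assms digit_0_add[OF swap_sites_less half_swap_less, of k N "{..<N}" x]
        digit_0_add[OF assms]
      by (simp add: digit_swap_sites)
  next
    case (Suc q)
    have "0 < 2 * n" using n by simp
    then show ?thesis
      using Suc r digit_Suc_add[of q N "2 * n"]
      by (simp add: digit_swap_sites)
  qed
qed

end

section \<open>Permutation matrices and diagonal conjugation\<close>

text \<open>Sends the basis vector \<open>y\<close> to \<open>f y\<close>, so that products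
  correspond to compositions in the same order.\<close>

definition perm_mat :: "nat \<Rightarrow> (nat \<Rightarrow> nat) \<Rightarrow> complex mat" where
  "perm_mat D f = mat D D (\<lambda>(x, y). if x = f y then 1 else 0)"

text \<open>For an involution \<open>f\<close> of the index range this is conjugation by
  \<open>perm_mat D f\<close>, written without sums over intermediate indices.\<close>

definition reindex :: "nat \<Rightarrow> (nat \<Rightarrow> nat) \<Rightarrow> complex mat \<Rightarrow> complex mat" where
  "reindex D f A = mat D D (\<lambda>(x, y). A $$ (f x, f y))"

text \<open>For nowhere vanishing \<open>h\<close>, the conjugate of \<open>A\<close> by the
  diagonal matrix with entries \<open>h\<close>.\<close>

definition diag_conj :: "nat \<Rightarrow> (nat \<Rightarrow> complex) \<Rightarrow> complex mat \<Rightarrow> complex mat" where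
  "diag_conj D h A = mat D D (\<lambda>(x, y). h x * A $$ (x, y) / h y)"

lemma perm_mat_carrier [simp]: "perm_mat D f \<in> carrier_mat D D"
  by (simp add: perm_mat_def)

lemma reindex_carrier [simp]: "reindex D f A \<in> carrier_mat D D"
  by (simp add: reindex_def)

lemma diag_conj_carrier [simp]: "diag_conj D h A \<in> carrier_mat D D"
  by (simp add: diag_conj_def)

lemma index_mult_mat_sum:
  "A \<in> carrier_mat D D \<Longrightarrow> B \<in> carrier_mat D D \<Longrightarrow> x < D \<Longrightarrow> y < D \<Longrightarrow>
    (A * B) $$ (x, y) = (\<Sum>k<D. A $$ (x, k) * B $$ (k, y))"
  by (simp add: scalar_prod_def atLeast0LessThan)

lemma perm_mat_mult_left:
  assumes "A \<in> carrier_mat D D" "\<And>x. x < D \<Longrightarrow> f x < D" "\<And>x. x < D \<Longrightarrow> f (f x) = x" "x < D" "y < D"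
  shows "(perm_mat D f * A) $$ (x, y) = A $$ (f x, y)"
proof -
  have "(perm_mat D f * A) $$ (x, y) = (\<Sum>k<D. perm_mat D f $$ (x, k) * A $$ (k, y))"
    using assms by (simp only: index_mult_mat_sum perm_mat_carrier)
  also have "\<dots> = (\<Sum>k<D. if k = f x then A $$ (k, y) else 0)"
  proof (intro sum.cong refl)
    fix k assume "k \<in> {..<D}"
    moreover from this have "x = f k \<longleftrightarrow> k = f x" using assms(3,4) by (metis lessThan_iff)
    ultimately show "perm_mat D f $$ (x, k) * A $$ (k, y) = (if k = f x then A $$ (k, y) else 0)"
      using \<open>x < D\<close> by (simp add: perm_mat_def)
  qed
  also have "\<dots> = A $$ (f x, y)"
    using assms(2)[OF \<open>x < D\<close>] by simp
  finally show ?thesis .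
qed

lemma perm_mat_mult_right:
  assumes "A \<in> carrier_mat D D" "\<And>x. x < D \<Longrightarrow> f x < D" "x < D" "y < D"
  shows "(A * perm_mat D f) $$ (x, y) = A $$ (x, f y)"
proof -
  have "(A * perm_mat D f) $$ (x, y) = (\<Sum>k<D. A $$ (x, k) * perm_mat D f $$ (k, y))"
    using assms by (simp only: index_mult_mat_sum perm_mat_carrier)
  also have "\<dots> = (\<Sum>k<D. if k = f y then A $$ (x, k) else 0)"
    using \<open>y < D\<close> by (intro sum.cong) (simp_all add: perm_mat_def)
  also have "\<dots> = A $$ (x, f y)"
    using assms(2)[OF \<open>y < D\<close>] by simp
  finally show ?thesis .
qed

lemma perm_mat_mult_perm_mat:
  assumes "\<And>x. x < D \<Longrightarrow> g x < D"
  shows "perm_mat D f * perm_mat D g = perm_mat D (f \<circ> g)"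
proof (rule eq_matI)
  fix x y assume "x < dim_row (perm_mat D (f \<circ> g))" "y < dim_col (perm_mat D (f \<circ> g))"
  then have "x < D" "y < D" by (simp_all add: perm_mat_def)
  with assms show "(perm_mat D f * perm_mat D g) $$ (x, y) = perm_mat D (f \<circ> g) $$ (x, y)"
    by (subst perm_mat_mult_right) (simp_all add: perm_mat_def)
qed (simp_all add: perm_mat_def)

lemma perm_mat_id: "(\<And>x. x < D \<Longrightarrow> f x = x) \<Longrightarrow> perm_mat D f = 1\<^sub>m D"
  by (rule eq_matI) (auto simp: perm_mat_def)

lemma perm_mat_conj:
  assumes "A \<in> carrier_mat D D" "\<And>x. x < D \<Longrightarrow> f x < D" "\<And>x. x < D \<Longrightarrow> f (f x) = x"
  shows "perm_mat D f * A * perm_mat D f = reindex D f A"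
proof (rule eq_matI)
  fix x y assume "x < dim_row (reindex D f A)" "y < dim_col (reindex D f A)"
  then have xy: "x < D" "y < D" by (simp_all add: reindex_def)
  have "perm_mat D f * A \<in> carrier_mat D D" using assms by (meson mult_carrier_mat perm_mat_carrier)
  with assms xy show "(perm_mat D f * A * perm_mat D f) $$ (x, y) = reindex D f A $$ (x, y)"
    by (subst perm_mat_mult_right) (simp_all add: perm_mat_mult_left reindex_def del: index_mult_mat)
qed (simp_all add: perm_mat_def reindex_def)

text \<open>As an involution, \<open>f\<close> permutes the summation range of the matrix
  product.\<close>

lemma reindex_mult:
  assumes "A \<in> carrier_mat D D" "B \<in> carrier_mat D D" "\<And>x. x < D \<Longrightarrow> f x < D"
    "\<And>x. x < D \<Longrightarrow> f (f x) = x"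
  shows "reindex D f (A * B) = reindex D f A * reindex D f B"
proof (rule eq_matI)
  fix x y assume "x < dim_row (reindex D f A * reindex D f B)" "y < dim_col (reindex D f A * reindex D f B)"
  then have xy: "x < D" "y < D" by (simp_all add: reindex_def)
  have "(\<Sum>k<D. A $$ (f x, k) * B $$ (k, f y)) = (\<Sum>k<D. A $$ (f x, f k) * B $$ (f k, f y))"
    using assms by (intro sum.reindex_bij_witness[of _ f f]) auto
  then show "reindex D f (A * B) $$ (x, y) = (reindex D f A * reindex D f B) $$ (x, y)"
    using assms xy by (subst index_mult_mat_sum[OF reindex_carrier reindex_carrier])
      (simp_all add: reindex_def index_mult_mat_sum del: index_mult_mat)
qed (simp_all add: reindex_def)

lemma diag_conj_mult:
  assumes "A \<in> carrier_mat D D" "B \<in> carrier_mat D D" "\<And>x. x < D \<Longrightarrow> h x \<noteq> 0"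
  shows "diag_conj D h (A * B) = diag_conj D h A * diag_conj D h B"
proof (rule eq_matI)
  fix x y assume "x < dim_row (diag_conj D h A * diag_conj D h B)" "y < dim_col (diag_conj D h A * diag_conj D h B)"
  then have xy: "x < D" "y < D" by (simp_all add: diag_conj_def)
  have "(\<Sum>k<D. h x * (A $$ (x, k) * B $$ (k, y)) / h y) =
        (\<Sum>k<D. (h x * A $$ (x, k) / h k) * (h k * B $$ (k, y) / h y))"
    using assms by (intro sum.cong) simp_all
  then show "diag_conj D h (A * B) $$ (x, y) = (diag_conj D h A * diag_conj D h B) $$ (x, y)"
    using assms xy by (subst index_mult_mat_sum[OF diag_conj_carrier diag_conj_carrier])
      (simp_all add: diag_conj_def index_mult_mat_sum sum_distrib_left sum_divide_distrib del: index_mult_mat)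
qed (simp_all add: diag_conj_def)

lemma mat_prod_carrier: "(\<And>A. A \<in> set As \<Longrightarrow> A \<in> carrier_mat D D) \<Longrightarrow> mat_prod D As \<in> carrier_mat D D"
  by (induction As) (auto simp: mat_prod_def intro!: mult_carrier_mat)

text \<open>Both operations are multiplicative, so an identity for each factor passes to the
  product, the inner diagonal matrices cancelling. All factors must share the same \<open>h\<close>;
  for the monodromy matrices it depends on the auxiliary digit only.\<close>

lemma reindex_mat_prod:
  assumes "\<And>A. A \<in> set As \<Longrightarrow> A \<in> carrier_mat D D"
    and "\<And>A. A \<in> set As \<Longrightarrow> reindex D f A = diag_conj D h A"
    and f: "\<And>x. x < D \<Longrightarrow> f x < D" "\<And>x. x < D \<Longrightarrow> f (f x) = x" and h: "\<And>x. x < D \<Longrightarrow> h x \<noteq> 0"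
  shows "reindex D f (mat_prod D As) = diag_conj D h (mat_prod D As)"
  using assms(1,2)
proof (induction As)
  case Nil
  show ?case
  proof (rule eq_matI)
    fix x y assume "x < dim_row (diag_conj D h (mat_prod D []))" "y < dim_col (diag_conj D h (mat_prod D []))"
    then have "x < D" "y < D" by (simp_all add: diag_conj_def)
    \<comment> \<open>Injectivity of \<open>f\<close> keeps the off-diagonal entries of the identity
      at 0, and on the diagonal \<open>h\<close> cancels.\<close>
    moreover from this have "f x < D" "f y < D" "f x = f y \<longleftrightarrow> x = y" "h y \<noteq> 0"
      using f h by metis+
    ultimately show "reindex D f (mat_prod D []) $$ (x, y) = diag_conj D h (mat_prod D []) $$ (x, y)"
      by (simp add: mat_prod_def reindex_def diag_conj_def)
  qed (simp_all add: reindex_def diag_conj_def)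
next
  case (Cons A As)
  have "mat_prod D As \<in> carrier_mat D D" using Cons.prems by (intro mat_prod_carrier) simp
  moreover have "mat_prod D (A # As) = A * mat_prod D As" by (simp add: mat_prod_def)
  ultimately show ?case
    using Cons f h by (simp add: reindex_mult diag_conj_mult)
qed

lemma dim_mat_diag [simp]: "dim_row (mat_diag n f) = n" "dim_col (mat_diag n f) = n"
  by (simp_all add: mat_diag_def)

lemma diag_mult_mat_diag:
  assumes "A \<in> carrier_mat D D" "x < D" "y < D"
  shows "(mat_diag D k * A * mat_diag D l) $$ (x, y) = k x * A $$ (x, y) * l y"
  using assms by (simp add: mat_diag_mult_left[of _ D D] mat_diag_mult_right[of _ D D])

section \<open>The operators under the index permutation\<close>

lemma op2_carrier [simp]: "op2 d m k l A \<in> carrier_mat (d ^ m) (d ^ m)"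
  by (simp add: op2_def)

lemma op1_mat_diag:
  assumes "k < m" "d > 0"
  shows "op1 d m k (mat_diag d f) = mat_diag (d ^ m) (\<lambda>x. f (digit d m k x))"
proof (rule eq_matI)
  fix x y assume "x < dim_row (mat_diag (d ^ m) (\<lambda>x. f (digit d m k x)))"
    "y < dim_col (mat_diag (d ^ m) (\<lambda>x. f (digit d m k x)))"
  then have xy: "x < d ^ m" "y < d ^ m" by simp_all
  have "(\<forall>r<m. r \<noteq> k \<longrightarrow> digit d m r x = digit d m r y) \<and> digit d m k x = digit d m k y \<longleftrightarrow> x = y"
    using digits_eqI[OF xy] by metis
  then show "op1 d m k (mat_diag d f) $$ (x, y) = mat_diag (d ^ m) (\<lambda>x. f (digit d m k x)) $$ (x, y)"
    using xy assms by (auto simp: op1_def mat_diag_def digit_less)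
qed (simp_all add: op1_def)

lemma U_mat_index: "i < 2 * n \<Longrightarrow> j < 2 * n \<Longrightarrow> U_mat n $$ (i, j) = (if i = half_swap n j then 1 else 0)"
  by (auto simp: U_mat_def half_swap_def)

context
  fixes n :: nat
  assumes n: "n \<ge> 1"
begin

lemma op1_U_mat:
  assumes "k < m"
  shows "op1 (2 * n) m k (U_mat n) = perm_mat ((2 * n) ^ m) (swap_sites n m {k})"
proof (rule eq_matI)
  fix x y assume "x < dim_row (perm_mat ((2 * n) ^ m) (swap_sites n m {k}))"
    "y < dim_col (perm_mat ((2 * n) ^ m) (swap_sites n m {k}))"
  then have xy: "x < (2 * n) ^ m" "y < (2 * n) ^ m" by (simp_all add: perm_mat_def)
  have "(\<forall>r<m. r \<noteq> k \<longrightarrow> digit (2 * n) m r x = digit (2 * n) m r y) \<and>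
      digit (2 * n) m k x = half_swap n (digit (2 * n) m k y) \<longleftrightarrow>
      (\<forall>r<m. digit (2 * n) m r x = digit (2 * n) m r (swap_sites n m {k} y))"
    using assms by (auto simp: digit_swap_sites[OF n])
  also have "\<dots> \<longleftrightarrow> x = swap_sites n m {k} y"
    using digits_eqI[OF xy(1) swap_sites_less[OF n]] by metis
  finally show "op1 (2 * n) m k (U_mat n) $$ (x, y) = perm_mat ((2 * n) ^ m) (swap_sites n m {k}) $$ (x, y)"
    using xy n by (auto simp: op1_def perm_mat_def U_mat_index digit_less)
qed (simp_all add: op1_def perm_mat_def)

lemma U_all_eq_perm_mat: "U_all n N = perm_mat ((2 * n) ^ N) (swap_sites n N {..<N})"
proof -
  \<comment> \<open>Stated for arbitrary duplicate-free lists to allow the induction; a repeated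
    site would be swapped back.\<close>
  have *: "mat_prod ((2 * n) ^ N) (map (\<lambda>k. op1 (2 * n) N k (U_mat n)) ks) =
      perm_mat ((2 * n) ^ N) (swap_sites n N (set ks))" if "distinct ks" "set ks \<subseteq> {..<N}" for ks
    using that
  proof (induction ks)
    case Nil
    then show ?case
      using swap_sites_empty[OF n] by (simp add: mat_prod_def perm_mat_id)
  next
    case (Cons k ks)
    then have "mat_prod ((2 * n) ^ N) (map (\<lambda>k. op1 (2 * n) N k (U_mat n)) (k # ks)) =
      perm_mat ((2 * n) ^ N) (swap_sites n N {k}) * perm_mat ((2 * n) ^ N) (swap_sites n N (set ks))"
      by (simp add: mat_prod_def op1_U_mat)
    also have "\<dots> = perm_mat ((2 * n) ^ N) (swap_sites n N {k} \<circ> swap_sites n N (set ks))"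
      by (intro perm_mat_mult_perm_mat swap_sites_less n)
    also have "swap_sites n N {k} \<circ> swap_sites n N (set ks) = swap_sites n N (insert k (set ks))"
      using Cons.prems swap_sites_insert[OF n] by auto
    finally show ?case by simp
  qed
  have "map (\<lambda>j. op1 (2 * n) N (j - 1) (U_mat n)) [1..<N + 1] =
      map (\<lambda>k. op1 (2 * n) N k (U_mat n)) [0..<N]"
    by (simp add: map_Suc_upt[symmetric] del: upt_Suc)
  then show ?thesis
    using *[of "[0..<N]"] by (simp add: U_all_def atLeast0LessThan)
qed

text \<open>The digits away from \<open>k\<close> and \<open>l\<close> agree before the permutation
  iff they agree after it, so an identity for the entries of the two-site matrix \<open>A\<close>
  lifts to the full space. The weight \<open>w\<close> takes both digits in order to serve for the
  auxiliary space in either slot.\<close>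

lemma reindex_op2:
  fixes N :: nat and A :: "complex mat" and h :: "nat \<Rightarrow> complex"
  defines "s \<equiv> half_swap n" and "\<Phi> \<equiv> swap_sites n (Suc N) {..<Suc N}"
  assumes kl: "k < Suc N" "l < Suc N"
    and A: "\<And>a b c e. \<lbrakk>a < 2 * n; b < 2 * n; c < 2 * n; e < 2 * n\<rbrakk> \<Longrightarrow>
      A $$ (s a * (2 * n) + s b, s c * (2 * n) + s e) =
      w a b * A $$ (a * (2 * n) + b, c * (2 * n) + e) / w c e"
    and h: "\<And>x. h x = w (digit (2 * n) (Suc N) k x) (digit (2 * n) (Suc N) l x)"
  shows "reindex ((2 * n) ^ Suc N) \<Phi> (op2 (2 * n) (Suc N) k l A) =
    diag_conj ((2 * n) ^ Suc N) h (op2 (2 * n) (Suc N) k l A)"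
proof (rule eq_matI)
  let ?D = "(2 * n) ^ Suc N" and ?d = "digit (2 * n) (Suc N)"
  fix x y assume "x < dim_row (diag_conj ?D h (op2 (2 * n) (Suc N) k l A))"
    "y < dim_col (diag_conj ?D h (op2 (2 * n) (Suc N) k l A))"
  then have xy: "x < ?D" "y < ?D" by (simp_all add: diag_conj_def)
  have \<Phi>: "\<Phi> x < ?D" "\<Phi> y < ?D" using swap_sites_less[OF n] by (simp_all only: \<Phi>_def)
  have dig: "?d r (\<Phi> z) = s (?d r z)" if "r < Suc N" for r z
    using that by (simp add: \<Phi>_def s_def digit_swap_sites[OF n])
  have less: "?d r z < 2 * n" for r z using n by (simp add: digit_less)
  have "s a = s b \<longleftrightarrow> a = b" if "a < 2 * n" "b < 2 * n" for a b
    using half_swap_half_swap that unfolding s_def by metis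
  then have agree: "(\<forall>r<Suc N. r \<noteq> k \<and> r \<noteq> l \<longrightarrow> ?d r (\<Phi> x) = ?d r (\<Phi> y)) \<longleftrightarrow>
      (\<forall>r<Suc N. r \<noteq> k \<and> r \<noteq> l \<longrightarrow> ?d r x = ?d r y)"
    using less by (simp add: dig)
  have index: "op2 (2 * n) (Suc N) k l A $$ (x, y) =
      (if \<forall>r<Suc N. r \<noteq> k \<and> r \<noteq> l \<longrightarrow> ?d r x = ?d r y
       then A $$ (?d k x * (2 * n) + ?d l x, ?d k y * (2 * n) + ?d l y) else 0)"
    if "x < ?D" "y < ?D" for x y
    using that by (simp add: op2_def del: power_Suc)
  show "reindex ?D \<Phi> (op2 (2 * n) (Suc N) k l A) $$ (x, y) =
      diag_conj ?D h (op2 (2 * n) (Suc N) k l A) $$ (x, y)"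
    unfolding reindex_def diag_conj_def using xy
    by (simp only: index_mat split index[OF xy] index[OF \<Phi>] agree dig[OF kl(1)] dig[OF kl(2)]
        A[OF less less less less] h) auto
qed (simp_all add: reindex_def diag_conj_def)

lemma reindex_mat_diag_digit:
  fixes N :: nat and f :: "nat \<Rightarrow> complex"
  defines "\<Phi> \<equiv> swap_sites n (Suc N) {..<Suc N}"
  shows "reindex ((2 * n) ^ Suc N) \<Phi> (mat_diag ((2 * n) ^ Suc N) (\<lambda>x. f (digit (2 * n) (Suc N) 0 x)))
    = mat_diag ((2 * n) ^ Suc N) (\<lambda>x. f (half_swap n (digit (2 * n) (Suc N) 0 x)))"
proof (rule eq_matI)
  let ?D = "(2 * n) ^ Suc N"
  fix x y assume "x < dim_row (mat_diag ?D (\<lambda>x. f (half_swap n (digit (2 * n) (Suc N) 0 x))))"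
   "y < dim_col (mat_diag ?D (\<lambda>x. f (half_swap n (digit (2 * n) (Suc N) 0 x))))"
  then have xy: "x < ?D" "y < ?D" by simp_all
  have \<Phi>: "\<Phi> x < ?D" "\<Phi> y < ?D" using swap_sites_less[OF n] by (simp_all only: \<Phi>_def)
  have "\<Phi> x = \<Phi> y \<longleftrightarrow> x = y"
    using swap_sites_swap_sites[OF n] xy unfolding \<Phi>_def by metis
  moreover have "digit (2 * n) (Suc N) 0 (\<Phi> x) = half_swap n (digit (2 * n) (Suc N) 0 x)" for x
    by (simp add: \<Phi>_def digit_swap_sites[OF n])
  ultimately show "reindex ?D \<Phi> (mat_diag ?D (\<lambda>x. f (digit (2 * n) (Suc N) 0 x))) $$ (x, y)
    = mat_diag ?D (\<lambda>x. f (half_swap n (digit (2 * n) (Suc N) 0 x))) $$ (x, y)"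
    using xy \<Phi> by (simp add: reindex_def mat_diag_def del: power_Suc)
qed (simp_all add: reindex_def)

lemma reindex_ptrace:
  assumes "A \<in> carrier_mat ((2 * n) ^ Suc N) ((2 * n) ^ Suc N)"
  shows "reindex ((2 * n) ^ N) (swap_sites n N {..<N}) (ptrace (2 * n) N A) =
    ptrace (2 * n) N (reindex ((2 * n) ^ Suc N) (swap_sites n (Suc N) {..<Suc N}) A)"
proof (rule eq_matI)
  let ?D = "(2 * n) ^ N" and ?\<phi> = "swap_sites n N {..<N}"
  fix x y assume "x < dim_row (ptrace (2 * n) N (reindex ((2 * n) ^ Suc N) (swap_sites n (Suc N) {..<Suc N}) A))"
    "y < dim_col (ptrace (2 * n) N (reindex ((2 * n) ^ Suc N) (swap_sites n (Suc N) {..<Suc N}) A))"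
  then have xy: "x < ?D" "y < ?D" by (simp_all add: ptrace_def)
  have lt: "k * ?D + x < (2 * n) ^ Suc N" if "k < 2 * n" "x < ?D" for k x
    using mult_add_less_mult[OF that] by simp
  \<comment> \<open>The full permutation also moves the auxiliary digit, but this digit is the trace
    index, and \<open>half_swap\<close> merely permutes its range.\<close>
  have "(\<Sum>k<2 * n. A $$ (k * ?D + ?\<phi> x, k * ?D + ?\<phi> y)) =
      (\<Sum>k<2 * n. A $$ (half_swap n k * ?D + ?\<phi> x, half_swap n k * ?D + ?\<phi> y))"
    by (intro sum.reindex_bij_witness[of _ "half_swap n" "half_swap n"])
      (auto simp: half_swap_less half_swap_half_swap)
  then show "reindex ?D ?\<phi> (ptrace (2 * n) N A) $$ (x, y) =
    ptrace (2 * n) N (reindex ((2 * n) ^ Suc N) (swap_sites n (Suc N) {..<Suc N}) A) $$ (x, y)"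
    using xy swap_sites_less[OF n] lt
    by (simp add: reindex_def ptrace_def swap_sites_Suc[OF n] del: power_Suc)
qed (simp_all add: reindex_def ptrace_def)

text \<open>A case of cyclicity: the traced entries have the same auxiliary digit \<open>k\<close>
  in row and column, so \<open>h k\<close> cancels.\<close>

lemma ptrace_diag_conj:
  assumes "A \<in> carrier_mat ((2 * n) ^ Suc N) ((2 * n) ^ Suc N)" "\<And>a. h a \<noteq> 0"
  shows "ptrace (2 * n) N (diag_conj ((2 * n) ^ Suc N) (\<lambda>x. h (digit (2 * n) (Suc N) 0 x)) A) =
    ptrace (2 * n) N A"
proof (rule eq_matI)
  let ?D = "(2 * n) ^ N"
  fix x y assume "x < dim_row (ptrace (2 * n) N A)" "y < dim_col (ptrace (2 * n) N A)"
  then have xy: "x < ?D" "y < ?D" by (simp_all add: ptrace_def)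
  have lt: "k * ?D + x < (2 * n) ^ Suc N" if "k < 2 * n" "x < ?D" for k x
    using mult_add_less_mult[OF that] by simp
  show "ptrace (2 * n) N (diag_conj ((2 * n) ^ Suc N) (\<lambda>x. h (digit (2 * n) (Suc N) 0 x)) A) $$ (x, y)
    = ptrace (2 * n) N A $$ (x, y)"
    using xy lt assms by (simp add: ptrace_def diag_conj_def digit_0_add del: power_Suc)
qed (simp_all add: ptrace_def)

end

section \<open>Crossing the halves in the R-matrix\<close>

text \<open>The diagonal entries of \<open>G(u)\<close>. Their quotients are 1 within a half and
  exp(u) or exp(-u) across the halves, matching the ratio of \<open>R_ebar\<close> to
  \<open>R_e\<close>.\<close>

definition gauge :: "nat \<Rightarrow> complex \<Rightarrow> nat \<Rightarrow> complex" where
  "gauge n u a = (if a < n then exp (u / 2) else exp (- u / 2))"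

lemma gauge_nonzero [simp]: "gauge n u a \<noteq> 0"
  by (simp add: gauge_def)

section \<open>Entries of the R-matrix\<close>

lemma kron_elem_mat_index:
  assumes "a < 2 * n" "b < 2 * n" "c < 2 * n" "e < 2 * n"
  shows "kron (elem_mat n \<alpha> \<beta>) (elem_mat n \<gamma> \<delta>) $$ (a * (2 * n) + b, c * (2 * n) + e) =
    (if a + 1 = \<alpha> \<and> c + 1 = \<beta> \<and> b + 1 = \<gamma> \<and> e + 1 = \<delta> then 1 else 0)"
proof -
  have "(a * (2 * n) + b) div (2 * n) = a" "(a * (2 * n) + b) mod (2 * n) = b"
    if "b < 2 * n" for a b
    using that by simp_all
  then show ?thesis
    using assms mult_add_less_mult[of a "2 * n" b "2 * n"] mult_add_less_mult[of c "2 * n" e "2 * n"]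
    by (simp add: kron_def elem_mat_def)
qed

lemma sum_pair_delta:
  assumes "finite S" and zero: "\<And>\<alpha> \<beta>. (\<alpha>, \<beta>) \<noteq> (x, y) \<Longrightarrow> f \<alpha> \<beta> = 0"
  shows "(\<Sum>(\<alpha>, \<beta>)\<in>S. f \<alpha> \<beta>) = (if (x, y) \<in> S then f x y else 0)"
proof -
  have "(\<Sum>(\<alpha>, \<beta>)\<in>S. f \<alpha> \<beta>) = (\<Sum>z\<in>S. if z = (x, y) then f x y else 0)"
    by (intro sum.cong refl) (metis case_prod_conv surj_pair zero)
  then show ?thesis using assms(1) by simp
qed

text \<open>At most one term of each sum contributes to a given entry. The sums with
  \<open>R_e\<close> and \<open>R_ebar\<close> run over disjoint sets of pairs and merge into one
  summand.\<close>

lemma R_mat_index: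
  assumes "a < 2 * n" "b < 2 * n" "c < 2 * n" "e < 2 * n"
  shows "R_mat g n \<eta> u $$ (a * (2 * n) + b, c * (2 * n) + e) =
      (if a = b \<and> a = c \<and> a = e then R_c g n \<eta> u else 0)
    + (if a \<noteq> b \<and> a + b + 1 \<noteq> 2 * n \<and> a = c \<and> b = e then R_b g n \<eta> u else 0)
    + (if a \<noteq> c \<and> a + c + 1 \<noteq> 2 * n \<and> b = c \<and> e = a
       then (if a < c then R_e g n \<eta> u else R_ebar g n \<eta> u) else 0)
    + (if a + b + 1 = 2 * n \<and> c + e + 1 = 2 * n then R_a g n \<eta> (a + 1) (c + 1) u else 0)"
proof -
  let ?I = "{1..2 * n}"
  let ?ij = "(a * (2 * n) + b, c * (2 * n) + e)"
  define EE where "EE \<alpha> \<beta> \<gamma> \<delta> = kron (elem_mat n \<alpha> \<beta>) (elem_mat n \<gamma> \<delta>) $$ ?ij" for \<alpha> \<beta> \<gamma> \<delta>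
  have EE: "EE \<alpha> \<beta> \<gamma> \<delta> = (if a + 1 = \<alpha> \<and> c + 1 = \<beta> \<and> b + 1 = \<gamma> \<and> e + 1 = \<delta> then 1 else 0)"
    for \<alpha> \<beta> \<gamma> \<delta>
    unfolding EE_def by (rule kron_elem_mat_index[OF assms])
  \<comment> \<open>With indices counted from 0, the relation \<alpha> = \<beta>' says that the two
    indices add up to \<open>2 * n - 1\<close>.\<close>
  have prime: "x + 1 = prime_index n (y + 1) \<longleftrightarrow> x + y + 1 = 2 * n" if "x < 2 * n" "y < 2 * n" for x y
    using that by (auto simp: prime_index_def)
  have fin: "finite {(\<alpha>, \<beta>)\<in>?I \<times> ?I. Q \<alpha> \<beta>}" for Q
    by (rule finite_subset[of _ "?I \<times> ?I"]) auto
  have "R_mat g n \<eta> u $$ ?ij =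
     R_c g n \<eta> u * (\<Sum>\<alpha>\<in>?I. EE \<alpha> \<alpha> \<alpha> \<alpha>)
     + R_b g n \<eta> u *
         (\<Sum>(\<alpha>, \<beta>)\<in>{(\<alpha>, \<beta>)\<in>?I \<times> ?I. \<alpha> \<noteq> \<beta> \<and> \<alpha> \<noteq> prime_index n \<beta>}. EE \<alpha> \<alpha> \<beta> \<beta>)
     + R_e g n \<eta> u *
         (\<Sum>(\<alpha>, \<beta>)\<in>{(\<alpha>, \<beta>)\<in>?I \<times> ?I. \<alpha> < \<beta> \<and> \<alpha> \<noteq> prime_index n \<beta>}. EE \<alpha> \<beta> \<beta> \<alpha>)
     + R_ebar g n \<eta> u *
         (\<Sum>(\<alpha>, \<beta>)\<in>{(\<alpha>, \<beta>)\<in>?I \<times> ?I. \<alpha> > \<beta> \<and> \<alpha> \<noteq> prime_index n \<beta>}. EE \<alpha> \<beta> \<beta> \<alpha>)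
     + (\<Sum>(\<alpha>, \<beta>)\<in>?I \<times> ?I. R_a g n \<eta> \<alpha> \<beta> u * EE \<alpha> \<beta> (prime_index n \<alpha>) (prime_index n \<beta>))"
    using mult_add_less_mult[OF assms(1,2)] mult_add_less_mult[OF assms(3,4)]
    unfolding R_mat_def EE_def Let_def by (subst index_mat) simp_all
  moreover have "(\<Sum>\<alpha>\<in>?I. EE \<alpha> \<alpha> \<alpha> \<alpha>) = (if a = b \<and> a = c \<and> a = e then 1 else 0)"
  proof -
    have "(\<Sum>\<alpha>\<in>?I. EE \<alpha> \<alpha> \<alpha> \<alpha>) = (\<Sum>\<alpha>\<in>?I. if \<alpha> = a + 1 then (if a = b \<and> a = c \<and> a = e then 1 else 0) else 0)"
      by (intro sum.cong) (auto simp: EE)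
    then show ?thesis using assms by simp
  qed
  moreover have "(\<Sum>(\<alpha>, \<beta>)\<in>{(\<alpha>, \<beta>)\<in>?I \<times> ?I. \<alpha> \<noteq> \<beta> \<and> \<alpha> \<noteq> prime_index n \<beta>}. EE \<alpha> \<alpha> \<beta> \<beta>) =
      (if a \<noteq> b \<and> a + b + 1 \<noteq> 2 * n \<and> a = c \<and> b = e then 1 else 0)"
    unfolding EE using assms prime[of a b]
    by (subst sum_pair_delta[where x = "a + 1" and y = "b + 1", OF fin]) auto
  moreover have "(\<Sum>(\<alpha>, \<beta>)\<in>{(\<alpha>, \<beta>)\<in>?I \<times> ?I. \<alpha> < \<beta> \<and> \<alpha> \<noteq> prime_index n \<beta>}. EE \<alpha> \<beta> \<beta> \<alpha>) =
      (if a < c \<and> a + c + 1 \<noteq> 2 * n \<and> b = c \<and> e = a then 1 else 0)"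
    unfolding EE using assms prime[of a c]
    by (subst sum_pair_delta[where x = "a + 1" and y = "c + 1", OF fin]) auto
  moreover have "(\<Sum>(\<alpha>, \<beta>)\<in>{(\<alpha>, \<beta>)\<in>?I \<times> ?I. \<alpha> > \<beta> \<and> \<alpha> \<noteq> prime_index n \<beta>}. EE \<alpha> \<beta> \<beta> \<alpha>) =
      (if a > c \<and> a + c + 1 \<noteq> 2 * n \<and> b = c \<and> e = a then 1 else 0)"
    unfolding EE using assms prime[of a c]
    by (subst sum_pair_delta[where x = "a + 1" and y = "c + 1", OF fin]) auto
  moreover have "(\<Sum>(\<alpha>, \<beta>)\<in>?I \<times> ?I. R_a g n \<eta> \<alpha> \<beta> u * EE \<alpha> \<beta> (prime_index n \<alpha>) (prime_index n \<beta>)) =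
      (if a + b + 1 = 2 * n \<and> c + e + 1 = 2 * n then R_a g n \<eta> (a + 1) (c + 1) u else 0)"
    unfolding EE using assms prime[of b a] prime[of e c]
    by (subst sum_pair_delta[where x = "a + 1" and y = "c + 1"]) (auto simp: add.commute)
  ultimately show ?thesis
    by auto
qed

text \<open>Within one half the order of the indices is kept and the gauge factors cancel. Across
  the halves the order flips, which exchanges \<open>R_e\<close> and \<open>R_ebar\<close>, and the
  gauge quotient supplies the missing exponential.\<close>

lemma R_e_half_swap:
  assumes "a < 2 * n" "c < 2 * n" "a \<noteq> c"
  shows "(if half_swap n a < half_swap n c then R_e g n \<eta> u else R_ebar g n \<eta> u) =
    gauge n u a * (if a < c then R_e g n \<eta> u else R_ebar g n \<eta> u) / gauge n u c"
proof -
  have "exp u = exp (u / 2) * exp (u / 2)" by (simp flip: exp_add)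
  with assms show ?thesis
    by (auto simp: half_swap_def gauge_def R_ebar_def exp_minus field_simps)
qed

text \<open>The jump of \<open>bar\<close> in the middle corrects the index shift \<open>n\<close>
  to \<open>n + 1\<close> for \<open>C_affine\<close> and \<open>n - 1\<close> for
  \<open>D_affine\<close>, which is half of \<open>kappa\<close> in both cases.\<close>

lemma bar_half_swap:
  assumes "a < 2 * n"
  shows "bar g n (half_swap n a + 1) = bar g n (a + 1) + (if a < n then kappa g n / 2 else - kappa g n / 2)"
  using assms by (cases g) (auto simp: bar_def half_swap_def kappa_def of_nat_diff field_simps)

text \<open>The sign depends on the type only, so products of two values of \<open>eps\<close> are
  invariant.\<close>

lemma eps_half_swap:
  assumes "a < 2 * n"
  shows "eps g n (half_swap n a + 1) = (case g of C_affine \<Rightarrow> - 1 | D_affine \<Rightarrow> 1) * eps g n (a + 1)"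
  using assms by (cases g) (auto simp: eps_def half_swap_def)

lemma prime_index_half_swap:
  assumes "a < 2 * n" "c < 2 * n"
  shows "half_swap n a + 1 = prime_index n (half_swap n c + 1) \<longleftrightarrow> a + 1 = prime_index n (c + 1)"
  using assms by (auto simp: half_swap_def prime_index_def split: if_splits)

text \<open>Across the halves the flip of the sign \<open>s\<close> changes the exponent by twice
  \<open>kappa\<close>, and the opposite shifts of the two \<open>bar\<close> values compensate for
  it. The product of the \<open>eps\<close> and the delta term are invariant, so only exp(-su/2)
  changes, by the gauge quotient.\<close>

lemma R_a_half_swap:
  assumes a: "a < 2 * n" and c: "c < 2 * n"
  shows "R_a g n \<eta> (half_swap n a + 1) (half_swap n c + 1) u =
    gauge n u a * R_a g n \<eta> (a + 1) (c + 1) u / gauge n u c"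
proof (cases "a = c")
  case True
  then show ?thesis by (simp add: R_a_def)
next
  case False
  let ?s = "\<lambda>a c :: nat. if a < c then 1 else - 1 :: complex"
  let ?K = "kappa g n"
  have ne: "half_swap n a \<noteq> half_swap n c"
    using False a c by (auto simp: half_swap_def)
  have eps: "eps g n (half_swap n a + 1) * eps g n (half_swap n c + 1) = eps g n (a + 1) * eps g n (c + 1)"
    using eps_half_swap[OF a, of g] eps_half_swap[OF c, of g] by (cases g) simp_all
  have arg: "?s (half_swap n a) (half_swap n c) * ?K + 2 * (bar g n (half_swap n a + 1) - bar g n (half_swap n c + 1))
    = ?s a c * ?K + 2 * (bar g n (a + 1) - bar g n (c + 1))"
    unfolding bar_half_swap[OF a] bar_half_swap[OF c] using False a c
    by (auto simp: half_swap_def algebra_simps)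
  have exp: "exp (- ?s (half_swap n a) (half_swap n c) * u / 2) =
    gauge n u a * exp (- ?s a c * u / 2) / gauge n u c"
    using False a c by (auto simp: half_swap_def gauge_def exp_minus field_simps)
  have unfold: "R_a g n \<eta> (x + 1) (y + 1) u = 2 * sinh (2 * \<eta>) * exp (- ?s x y * u / 2) *
      (eps g n (x + 1) * eps g n (y + 1) * exp ((?s x y * ?K + 2 * (bar g n (x + 1) - bar g n (y + 1))) * \<eta>) * sinh (u / 2)
       - (if x + 1 = prime_index n (y + 1) then 1 else 0) * sinh (u / 2 - ?K * \<eta>))"
    if "x \<noteq> y" for x y
    using that by (simp add: R_a_def Let_def)
  show ?thesis
    unfolding unfold[OF ne] unfold[OF False] eps arg exp prime_index_half_swap[OF a c] by simp
qed

lemma R_mat_half_swap_left: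
  assumes "a < 2 * n" "b < 2 * n" "c < 2 * n" "e < 2 * n"
  shows "R_mat g n \<eta> u $$ (half_swap n a * (2 * n) + half_swap n b, half_swap n c * (2 * n) + half_swap n e) =
    gauge n u a * R_mat g n \<eta> u $$ (a * (2 * n) + b, c * (2 * n) + e) / gauge n u c"
proof -
  have inj: "half_swap n x = half_swap n y \<longleftrightarrow> x = y" if "x < 2 * n" "y < 2 * n" for x y
    using half_swap_half_swap that by metis
  have prime: "half_swap n x + half_swap n y + 1 = 2 * n \<longleftrightarrow> x + y + 1 = 2 * n"
    if "x < 2 * n" "y < 2 * n" for x y
    using that by (auto simp: half_swap_def)
  have less: "half_swap n a < 2 * n" "half_swap n b < 2 * n" "half_swap n c < 2 * n" "half_swap n e < 2 * n"
    using assms by (simp_all add: half_swap_less)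
  have "(if half_swap n a \<noteq> half_swap n c \<and> P then
      (if half_swap n a < half_swap n c then R_e g n \<eta> u else R_ebar g n \<eta> u) else 0) =
    gauge n u a * (if a \<noteq> c \<and> P then (if a < c then R_e g n \<eta> u else R_ebar g n \<eta> u) else 0) / gauge n u c" for P
    using R_e_half_swap[of a n c] assms by (simp add: inj)
  \<comment> \<open>The terms with \<open>R_c\<close> and \<open>R_b\<close> are diagonal in the
    first factor, \<open>a = c\<close>, so the gauge cancels.\<close>
  moreover have "(if a = b \<and> a = c \<and> a = e then R_c g n \<eta> u else 0) =
      gauge n u a * (if a = b \<and> a = c \<and> a = e then R_c g n \<eta> u else 0) / gauge n u c"
    and "(if a \<noteq> b \<and> a + b + 1 \<noteq> 2 * n \<and> a = c \<and> b = e then R_b g n \<eta> u else 0) =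
      gauge n u a * (if a \<noteq> b \<and> a + b + 1 \<noteq> 2 * n \<and> a = c \<and> b = e then R_b g n \<eta> u else 0) / gauge n u c"
    by auto
  moreover have "(if P then R_a g n \<eta> (half_swap n a + 1) (half_swap n c + 1) u else 0) =
    gauge n u a * (if P then R_a g n \<eta> (a + 1) (c + 1) u else 0) / gauge n u c" for P
    using R_a_half_swap[of a n c] assms by simp
  ultimately show ?thesis
    unfolding R_mat_index[OF less] R_mat_index[OF assms]
    by (simp only: inj prime assms distrib_left add_divide_distrib)
qed

text \<open>Nonzero entries of the R-matrix conserve the product of the two gauge factors, so a
  gauge on the first factor can be traded for the inverse gauge on the second.\<close>

lemma R_mat_half_swap_right:
  assumes "a < 2 * n" "b < 2 * n" "c < 2 * n" "e < 2 * n"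
  shows "R_mat g n \<eta> u $$ (half_swap n a * (2 * n) + half_swap n b, half_swap n c * (2 * n) + half_swap n e) =
    inverse (gauge n u b) * R_mat g n \<eta> u $$ (a * (2 * n) + b, c * (2 * n) + e) / inverse (gauge n u e)"
proof (cases "R_mat g n \<eta> u $$ (a * (2 * n) + b, c * (2 * n) + e) = 0")
  case False
  \<comment> \<open>The indices \<alpha> and \<alpha>' always lie in opposite halves.\<close>
  have prime: "gauge n u x * gauge n u y = 1" if "x + y + 1 = 2 * n" for x y
    using that by (auto simp: gauge_def simp flip: exp_add)
  have "a = c \<and> b = e \<or> b = c \<and> e = a \<or> a + b + 1 = 2 * n \<and> c + e + 1 = 2 * n"
    using False unfolding R_mat_index[OF assms] by (auto split: if_splits)
  then have "gauge n u a * gauge n u b = gauge n u c * gauge n u e"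
    using prime by auto
  then show ?thesis
    unfolding R_mat_half_swap_left[OF assms] by (simp add: field_simps)
qed (simp add: R_mat_half_swap_left[OF assms])

section \<open>The K-matrices under the index permutation\<close>

definition K_R_diag :: "affine_type \<Rightarrow> nat \<Rightarrow> complex \<Rightarrow> complex \<Rightarrow> complex \<Rightarrow> nat \<Rightarrow> nat \<Rightarrow> complex" where
  "K_R_diag g n \<eta> \<gamma>\<^sub>0 u p i =
     (if i < p then exp (- u)
      else if i < 2 * n - p then (gam g n \<eta> \<gamma>\<^sub>0 p * exp u + 1) / (gam g n \<eta> \<gamma>\<^sub>0 p + exp u)
      else exp u)"

definition M_diag :: "affine_type \<Rightarrow> nat \<Rightarrow> complex \<Rightarrow> nat \<Rightarrow> complex" where
  "M_diag g n \<eta> i = (case g of C_affine \<Rightarrow> - 1 | D_affine \<Rightarrow> 1) *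
     exp (4 * ((2 * of_nat n + 1) / 2 - bar g n (i + 1)) * \<eta>)"

lemma K_R_eq_mat_diag: "K_R g n \<eta> \<gamma>\<^sub>0 u p = mat_diag (2 * n) (K_R_diag g n \<eta> \<gamma>\<^sub>0 u p)"
  by (simp add: K_R_def K_R_diag_def[abs_def] Let_def)

lemma K_L_eq_mat_diag:
  "K_L g n \<eta> \<gamma>\<^sub>0 u p = mat_diag (2 * n) (\<lambda>i. K_R_diag g n \<eta> \<gamma>\<^sub>0 (- u - rho g n \<eta>) p i * M_diag g n \<eta> i)"
proof -
  have "M_mat g n \<eta> = mat_diag (2 * n) (M_diag g n \<eta>)"
    unfolding M_mat_def M_diag_def by (rule eq_matI) (simp_all add: mat_diag_def)
  then show ?thesis
    by (simp add: K_L_def K_R_eq_mat_diag mat_diag_diag)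
qed

text \<open>The offset of 2 or -2 cancels against \<open>rho / 2\<close>, which is
  \<open>- kappa * \<eta>\<close>; hence both types share one parameter, and the right factor
  carries no type-dependent sign.\<close>

lemma gam_eq: "gam g n \<eta> \<gamma>\<^sub>0 p = \<gamma>\<^sub>0 * exp (- ((2 * of_nat n - 4 * of_nat p) * \<eta>))"
proof -
  have "(4 * of_nat p + 2) * \<eta> + rho C_affine n \<eta> / 2 = - ((2 * of_nat n - 4 * of_nat p) * \<eta>)"
    "(4 * of_nat p - 2) * \<eta> + rho D_affine n \<eta> / 2 = - ((2 * of_nat n - 4 * of_nat p) * \<eta>)"
    by (simp_all add: rho_def kappa_def field_simps)
  then show ?thesis
    by (cases g) (simp_all only: gam_def affine_type.case)
qed

text \<open>Passing from \<open>p\<close> to \<open>n - p\<close> negates 2n - 4p, and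
  \<open>\<gamma>\<^sub>0\<close> squares to 1.\<close>

lemma gam_dual:
  assumes "p \<le> n" "\<gamma>\<^sub>0 \<in> {1, - 1}"
  shows "gam g n \<eta> \<gamma>\<^sub>0 p * gam g n \<eta> \<gamma>\<^sub>0 (n - p) = 1"
proof -
  have "\<gamma>\<^sub>0 * \<gamma>\<^sub>0 = 1" using assms by auto
  moreover have "exp (- ((2 * of_nat n - 4 * of_nat p) * \<eta>)) * exp (- ((2 * of_nat n - 4 * of_nat (n - p)) * \<eta>)) = 1"
    using assms by (simp add: of_nat_diff algebra_simps flip: exp_add)
  ultimately show ?thesis by (simp add: gam_eq algebra_simps)
qed

lemma f_R_eq:
  assumes "\<gamma>\<^sub>0 \<in> {1, - 1}"
  shows "f_R n \<eta> \<gamma>\<^sub>0 u p = (gam g n \<eta> \<gamma>\<^sub>0 p * exp u + 1) / (gam g n \<eta> \<gamma>\<^sub>0 p + exp u)"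
proof -
  define w where "w = exp ((2 * of_nat n - 4 * of_nat p) * \<eta>)"
  have w: "w \<noteq> 0" by (simp add: w_def)
  have gam: "gam g n \<eta> \<gamma>\<^sub>0 p = \<gamma>\<^sub>0 / w" unfolding gam_eq w_def exp_minus by (simp add: field_simps)
  \<comment> \<open>Extending a fraction by the nonzero \<open>w\<close> stays valid where the
    denominator vanishes, both sides being 0 there.\<close>
  have "(\<gamma>\<^sub>0 / w * exp u + 1) / (\<gamma>\<^sub>0 / w + exp u) =
      (w * (\<gamma>\<^sub>0 / w * exp u + 1)) / (w * (\<gamma>\<^sub>0 / w + exp u))"
    using w by (subst mult_divide_mult_cancel_left) simp_all
  also have "\<dots> = (\<gamma>\<^sub>0 * exp u + w) / (\<gamma>\<^sub>0 + exp u * w)"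
    using w by (simp add: distrib_left mult.commute)
  finally show ?thesis
    unfolding gam by (simp add: f_R_def exp_add w_def)
qed

text \<open>Here \<open>k\<close> is exp(-rho), since -rho = 2 kappa \<eta>, so exp(-u-rho) becomes
  \<open>k / x\<close>. The two fractions agree after extending the left one by
  \<open>w * \<gamma>\<^sub>0\<close> and the right one by \<open>x\<close>.\<close>

lemma f_L_eq:
  assumes "\<gamma>\<^sub>0 \<in> {1, - 1}"
  shows "f_L g n \<eta> \<gamma>\<^sub>0 u p = f_R n \<eta> \<gamma>\<^sub>0 (- u - rho g n \<eta>) p"
proof -
  define x where "x = exp u"
  define k where "k = exp ((4 * of_nat n + pm g * 4) * \<eta>)"
  define w where "w = exp ((2 * of_nat n - 4 * of_nat p) * \<eta>)"
  have nz: "x \<noteq> 0" "k \<noteq> 0" "w \<noteq> 0" by (simp_all add: x_def k_def w_def)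
  have rho: "- rho g n \<eta> = (4 * of_nat n + pm g * 4) * \<eta>"
    by (cases g) (simp_all add: rho_def kappa_def pm_def algebra_simps)
  have "exp (- u - rho g n \<eta>) = exp (- u) * exp (- rho g n \<eta>)"
    by (simp flip: exp_add)
  then have e1: "exp (- u - rho g n \<eta>) = k / x"
    unfolding rho k_def x_def exp_minus by (simp add: field_simps)
  have "(4 * of_nat p + 2 * of_nat n + pm g * 4) * \<eta> =
      (4 * of_nat n + pm g * 4) * \<eta> - (2 * of_nat n - 4 * of_nat p) * \<eta>"
    by (simp add: algebra_simps)
  then have e2: "exp ((4 * of_nat p + 2 * of_nat n + pm g * 4) * \<eta>) = k / w"
    unfolding k_def w_def by (simp only: exp_diff)
  have "u + (4 * of_nat p - 2 * of_nat n) * \<eta> = u - (2 * of_nat n - 4 * of_nat p) * \<eta>"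
    by (simp add: algebra_simps)
  then have e3: "exp (u + (4 * of_nat p - 2 * of_nat n) * \<eta>) = x / w"
    unfolding x_def w_def by (simp only: exp_diff)
  have "f_L g n \<eta> \<gamma>\<^sub>0 u p = (\<gamma>\<^sub>0 * x + k / w) / (\<gamma>\<^sub>0 * k + x / w)"
    unfolding f_L_def e2 e3 by (simp add: x_def k_def)
  also have "\<dots> = (w * \<gamma>\<^sub>0 * (\<gamma>\<^sub>0 * x + k / w)) / (w * \<gamma>\<^sub>0 * (\<gamma>\<^sub>0 * k + x / w))"
    using nz assms by (subst mult_divide_mult_cancel_left) auto
  also have "\<dots> = (x * (\<gamma>\<^sub>0 * (k / x) + w)) / (x * (\<gamma>\<^sub>0 + k / x * w))"
  proof (rule arg_cong2[where f = "(/)"])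
    have "\<gamma>\<^sub>0 * \<gamma>\<^sub>0 = 1" using assms by auto
    then show "w * \<gamma>\<^sub>0 * (\<gamma>\<^sub>0 * x + k / w) = x * (\<gamma>\<^sub>0 * (k / x) + w)"
      "w * \<gamma>\<^sub>0 * (\<gamma>\<^sub>0 * k + x / w) = x * (\<gamma>\<^sub>0 + k / x * w)"
      using nz by (simp_all add: distrib_left ac_simps)
  qed
  also have "\<dots> = (\<gamma>\<^sub>0 * (k / x) + w) / (\<gamma>\<^sub>0 + k / x * w)"
    using nz by (subst mult_divide_mult_cancel_left) simp_all
  also have "\<dots> = f_R n \<eta> \<gamma>\<^sub>0 (- u - rho g n \<eta>) p"
    unfolding f_R_def exp_add e1 by (simp add: w_def)
  finally show ?thesis .
qed

lemma K_R_half_swap: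
  assumes p: "p \<le> n" and \<gamma>: "\<gamma>\<^sub>0 \<in> {1, - 1}" and i: "i < 2 * n"
    and nz: "gam g n \<eta> \<gamma>\<^sub>0 p + exp u \<noteq> 0" "gam g n \<eta> \<gamma>\<^sub>0 p * exp u + 1 \<noteq> 0"
  shows "K_R_diag g n \<eta> \<gamma>\<^sub>0 u p (half_swap n i) =
    f_R n \<eta> \<gamma>\<^sub>0 u p * gauge n u i ^ 2 * K_R_diag g n \<eta> \<gamma>\<^sub>0 u (n - p) i"
proof -
  define G where "G = gam g n \<eta> \<gamma>\<^sub>0 p"
  have G: "G \<noteq> 0" using \<gamma> by (auto simp: G_def gam_eq)
  have dual: "gam g n \<eta> \<gamma>\<^sub>0 (n - p) = 1 / G"
    using gam_dual[OF p \<gamma>, of g \<eta>] G by (simp add: G_def field_simps)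
  have f: "f_R n \<eta> \<gamma>\<^sub>0 u p = (G * exp u + 1) / (G + exp u)"
    unfolding G_def by (rule f_R_eq[OF \<gamma>])
  \<comment> \<open>The middle entry of the dual K-matrix is the reciprocal of \<open>f_R\<close>;
    this is where numerator and denominator must both be nonzero.\<close>
  have "(1 / G * exp u + 1) / (1 / G + exp u) = (G * (1 / G * exp u + 1)) / (G * (1 / G + exp u))"
    using G by (subst mult_divide_mult_cancel_left) simp_all
  also have "\<dots> = (G + exp u) / (G * exp u + 1)"
    using G by (simp add: distrib_left add.commute)
  finally have inv: "f_R n \<eta> \<gamma>\<^sub>0 u p * ((1 / G * exp u + 1) / (1 / G + exp u)) = 1"
    using nz unfolding f by (simp add: G_def)
  have e: "exp (u / 2) ^ 2 = exp u" "exp (- (u / 2)) ^ 2 = exp (- u)"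
    by (simp_all flip: exp_of_nat_mult)
  have ee: "exp u * exp (- u) = 1" by (simp flip: exp_add)
  \<comment> \<open>The cuts at \<open>n - p\<close> and \<open>n + p\<close> bound the blocks of
    the dual K-matrix; the cut at \<open>n\<close> is where the gauge jumps and where the two
    swapped end blocks of length \<open>p\<close> meet.\<close>
  consider "i < n - p" | "n - p \<le> i" "i < n" | "n \<le> i" "i < n + p" | "n + p \<le> i" by linarith
  then show ?thesis
  proof cases
    case 1
    then have "K_R_diag g n \<eta> \<gamma>\<^sub>0 u p (half_swap n i) = f_R n \<eta> \<gamma>\<^sub>0 u p"
      "K_R_diag g n \<eta> \<gamma>\<^sub>0 u (n - p) i = exp (- u)" "gauge n u i ^ 2 = exp u"
      using p by (auto simp: K_R_diag_def half_swap_def gauge_def f G_def e)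
    then show ?thesis by (simp add: mult.assoc ee)
  next
    case 2
    then have "K_R_diag g n \<eta> \<gamma>\<^sub>0 u p (half_swap n i) = exp u"
      "K_R_diag g n \<eta> \<gamma>\<^sub>0 u (n - p) i = (1 / G * exp u + 1) / (1 / G + exp u)" "gauge n u i ^ 2 = exp u"
      using p by (auto simp: K_R_diag_def half_swap_def gauge_def dual e)
    then show ?thesis using inv by (simp only: ac_simps mult_1_left mult_1_right)
  next
    case 3
    then have "K_R_diag g n \<eta> \<gamma>\<^sub>0 u p (half_swap n i) = exp (- u)"
      "K_R_diag g n \<eta> \<gamma>\<^sub>0 u (n - p) i = (1 / G * exp u + 1) / (1 / G + exp u)" "gauge n u i ^ 2 = exp (- u)"
      using p by (auto simp: K_R_diag_def half_swap_def gauge_def dual e)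
    then show ?thesis using inv by (simp only: ac_simps mult_1_left mult_1_right)
  next
    case 4
    then have "K_R_diag g n \<eta> \<gamma>\<^sub>0 u p (half_swap n i) = f_R n \<eta> \<gamma>\<^sub>0 u p"
      "K_R_diag g n \<eta> \<gamma>\<^sub>0 u (n - p) i = exp u" "gauge n u i ^ 2 = exp (- u)"
      using p i by (auto simp: K_R_diag_def half_swap_def gauge_def f G_def e)
    then show ?thesis using ee by (simp add: mult.assoc mult.commute[of "exp (- u)"])
  qed
qed

text \<open>The two squared gauges combine to exp(-rho) on the first half and exp(rho) on the
  second, free of \<open>u\<close>. This cancels the effect of shifting \<open>bar\<close> by half
  of \<open>kappa\<close>, which with the coefficient 4\<eta> changes the exponent by rho or
  -rho.\<close>

lemma M_half_swap:
  assumes "i < 2 * n"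
  shows "gauge n (- u - rho g n \<eta>) i ^ 2 * gauge n u i ^ 2 * M_diag g n \<eta> (half_swap n i) = M_diag g n \<eta> i"
proof -
  have sq: "exp (x / 2) ^ 2 = exp x" for x :: complex
    by (simp flip: exp_of_nat_mult)
  have "gauge n v i ^ 2 = exp (if i < n then v else - v)" for v
    using sq[of v] sq[of "- v"] by (simp add: gauge_def)
  then have "gauge n (- u - rho g n \<eta>) i ^ 2 * gauge n u i ^ 2 = exp (if i < n then - rho g n \<eta> else rho g n \<eta>)"
    by (simp flip: exp_add)
  then show ?thesis
    unfolding M_diag_def bar_half_swap[OF assms]
    by (simp add: rho_def algebra_simps flip: exp_add)
qed

text \<open>The law of the right K-matrix at -u-rho produces a squared gauge at that argument;
  \<open>M_half_swap\<close> absorbs it together with the squared gauge at \<open>u\<close>.\<close>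

lemma K_L_half_swap:
  assumes p: "p \<le> n" and \<gamma>: "\<gamma>\<^sub>0 \<in> {1, - 1}" and i: "i < 2 * n"
    and nz: "gam g n \<eta> \<gamma>\<^sub>0 p + exp (- u - rho g n \<eta>) \<noteq> 0" "gam g n \<eta> \<gamma>\<^sub>0 p * exp (- u - rho g n \<eta>) + 1 \<noteq> 0"
  shows "gauge n u i ^ 2 * (K_R_diag g n \<eta> \<gamma>\<^sub>0 (- u - rho g n \<eta>) p (half_swap n i) * M_diag g n \<eta> (half_swap n i)) =
    f_L g n \<eta> \<gamma>\<^sub>0 u p * (K_R_diag g n \<eta> \<gamma>\<^sub>0 (- u - rho g n \<eta>) (n - p) i * M_diag g n \<eta> i)"
  unfolding K_R_half_swap[OF p \<gamma> i nz] f_L_eq[OF \<gamma>] M_half_swap[OF i, of u g \<eta>, symmetric]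
  by (simp only: ac_simps)

section \<open>The transfer matrix\<close>

lemma eventually_cosparse_exp_neq: "\<forall>\<^sub>\<approx>u. exp u \<noteq> (c :: complex)"
  unfolding eventually_cosparse_open_eq[OF open_UNIV]
proof
  fix z :: complex
  show "\<forall>\<^sub>F u in at z. exp u \<noteq> c"
  proof (cases "exp z = c")
    case True
    \<comment> \<open>\<open>exp\<close> is injective on this ball, so \<open>z\<close> is the only
      solution in it.\<close>
    have "\<forall>\<^sub>F u in at z. u \<in> ball z pi - {z}"
      by (intro eventually_at_in_open) simp_all
    then show ?thesis
    proof eventually_elim
      case (elim u)
      then show ?case using inj_on_exp_pi[of z] True by (auto dest: inj_onD)
    qed
  next
    case False
    have "isCont exp z" by simp
    then show ?thesis
      using False by (simp add: isCont_def tendsto_imp_eventually_ne)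
  qed
qed

lemma ptrace_smult: "A \<in> carrier_mat (d ^ Suc N) (d ^ Suc N) \<Longrightarrow> ptrace d N (f \<cdot>\<^sub>m A) = f \<cdot>\<^sub>m ptrace d N A"
proof (rule eq_matI)
  let ?D = "d ^ N"
  fix x y assume A: "A \<in> carrier_mat (d ^ Suc N) (d ^ Suc N)"
    and "x < dim_row (f \<cdot>\<^sub>m ptrace d N A)" "y < dim_col (f \<cdot>\<^sub>m ptrace d N A)"
  then have xy: "x < ?D" "y < ?D" by (simp_all add: ptrace_def)
  have lt: "k * ?D + x < d ^ Suc N" if "k < d" "x < ?D" for k x
    using mult_add_less_mult[OF that] by simp
  show "ptrace d N (f \<cdot>\<^sub>m A) $$ (x, y) = (f \<cdot>\<^sub>m ptrace d N A) $$ (x, y)"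
    using xy lt A by (simp add: ptrace_def sum_distrib_left carrier_matD del: power_Suc)
qed (simp_all add: ptrace_def)

lemma T_mono_carrier: "T_mono g n N \<eta> u \<in> carrier_mat ((2 * n) ^ Suc N) ((2 * n) ^ Suc N)"
  unfolding T_mono_def Suc_eq_plus1[symmetric] by (rule mat_prod_carrier) (auto simp del: power_Suc upt_Suc)

lemma T_hat_carrier: "T_hat g n N \<eta> u \<in> carrier_mat ((2 * n) ^ Suc N) ((2 * n) ^ Suc N)"
  unfolding T_hat_def Suc_eq_plus1[symmetric] by (rule mat_prod_carrier) (auto simp del: power_Suc upt_Suc)

context
  fixes n N :: nat and \<Phi> :: "nat \<Rightarrow> nat" and D :: nat
  assumes n: "n \<ge> 1"
  defines "\<Phi> \<equiv> swap_sites n (Suc N) {..<Suc N}" and "D \<equiv> (2 * n) ^ Suc N"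
begin

text \<open>The auxiliary space is the first slot of every R-matrix in \<open>T_mono\<close>, so the
  left form of the crossing law applies to each factor.\<close>

lemma reindex_T_mono:
  "reindex D \<Phi> (T_mono g n N \<eta> u) = diag_conj D (\<lambda>x. gauge n u (digit (2 * n) (Suc N) 0 x)) (T_mono g n N \<eta> u)"
  unfolding T_mono_def \<Phi>_def D_def Suc_eq_plus1[symmetric]
proof (rule reindex_mat_prod)
  fix A assume "A \<in> set (map (\<lambda>j. op2 (2 * n) (Suc N) 0 j (R_mat g n \<eta> u)) (rev [1..<Suc N]))"
  then obtain j where "j \<in> set (rev [1..<Suc N])" and A: "A = op2 (2 * n) (Suc N) 0 j (R_mat g n \<eta> u)"
    unfolding set_map by blast
  then have j: "j < Suc N" by auto
  show "A \<in> carrier_mat ((2 * n) ^ Suc N) ((2 * n) ^ Suc N)" unfolding A by (rule op2_carrier)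
  show "reindex ((2 * n) ^ Suc N) (swap_sites n (Suc N) {..<Suc N}) A =
    diag_conj ((2 * n) ^ Suc N) (\<lambda>x. gauge n u (digit (2 * n) (Suc N) 0 x)) A"
    unfolding A using j
    by (intro reindex_op2[OF n, where w = "\<lambda>a b. gauge n u a"] R_mat_half_swap_left) simp_all
qed (simp_all only: swap_sites_less[OF n] swap_sites_swap_sites[OF n] gauge_nonzero not_False_eq_True)

text \<open>In \<open>T_hat\<close> the auxiliary space is the second slot, so the right form
  applies and gives the inverse gauge.\<close>

lemma reindex_T_hat:
  "reindex D \<Phi> (T_hat g n N \<eta> u) =
    diag_conj D (\<lambda>x. inverse (gauge n u (digit (2 * n) (Suc N) 0 x))) (T_hat g n N \<eta> u)"
  unfolding T_hat_def \<Phi>_def D_def Suc_eq_plus1[symmetric]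
proof (rule reindex_mat_prod)
  fix A assume "A \<in> set (map (\<lambda>j. op2 (2 * n) (Suc N) j 0 (R_mat g n \<eta> u)) [1..<Suc N])"
  then obtain j where "j \<in> set [1..<Suc N]" and A: "A = op2 (2 * n) (Suc N) j 0 (R_mat g n \<eta> u)"
    unfolding set_map by blast
  then have j: "j < Suc N" by auto
  show "A \<in> carrier_mat ((2 * n) ^ Suc N) ((2 * n) ^ Suc N)" unfolding A by (rule op2_carrier)
  show "reindex ((2 * n) ^ Suc N) (swap_sites n (Suc N) {..<Suc N}) A =
    diag_conj ((2 * n) ^ Suc N) (\<lambda>x. inverse (gauge n u (digit (2 * n) (Suc N) 0 x))) A"
    unfolding A using j
    by (intro reindex_op2[OF n, where w = "\<lambda>a b. inverse (gauge n u b)"] R_mat_half_swap_right) simp_all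
qed (simp_all only: swap_sites_less[OF n] swap_sites_swap_sites[OF n] gauge_nonzero not_False_eq_True
  inverse_nonzero_iff_nonzero)

lemma transfer_eq:
  "transfer g n N \<eta> \<gamma>\<^sub>0 u p = ptrace (2 * n) N
    (mat_diag D (\<lambda>x. K_R_diag g n \<eta> \<gamma>\<^sub>0 (- u - rho g n \<eta>) p (digit (2 * n) (Suc N) 0 x) *
        M_diag g n \<eta> (digit (2 * n) (Suc N) 0 x)) * T_mono g n N \<eta> u *
     mat_diag D (\<lambda>x. K_R_diag g n \<eta> \<gamma>\<^sub>0 u p (digit (2 * n) (Suc N) 0 x)) * T_hat g n N \<eta> u)"
  unfolding transfer_def K_L_eq_mat_diag K_R_eq_mat_diag D_def using n
  by (subst (1 2) op1_mat_diag) simp_all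

text \<open>The conditions \<open>R\<close> and \<open>L\<close> keep \<open>u\<close> away from the
  zeros and poles of the right and the left factor, respectively.\<close>

lemma transfer_dual:
  assumes p: "p \<le> n" and \<gamma>: "\<gamma>\<^sub>0 \<in> {1, - 1}"
    and R: "gam g n \<eta> \<gamma>\<^sub>0 p + exp u \<noteq> 0" "gam g n \<eta> \<gamma>\<^sub>0 p * exp u + 1 \<noteq> 0"
    and L: "gam g n \<eta> \<gamma>\<^sub>0 p + exp (- u - rho g n \<eta>) \<noteq> 0" "gam g n \<eta> \<gamma>\<^sub>0 p * exp (- u - rho g n \<eta>) + 1 \<noteq> 0"
  shows "reindex ((2 * n) ^ N) (swap_sites n N {..<N}) (transfer g n N \<eta> \<gamma>\<^sub>0 u p) =
    f_dual g n \<eta> \<gamma>\<^sub>0 u p \<cdot>\<^sub>m transfer g n N \<eta> \<gamma>\<^sub>0 u (n - p)"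
proof -
  let ?s = "half_swap n" and ?f = "f_dual g n \<eta> \<gamma>\<^sub>0 u p"
  define dg where "dg = digit (2 * n) (Suc N) 0"
  define h where "h x = gauge n u (dg x)" for x
  define h' where "h' x = inverse (gauge n u (dg x))" for x
  define T where "T = T_mono g n N \<eta> u"
  define T' where "T' = T_hat g n N \<eta> u"
  define kl where "kl p i = K_R_diag g n \<eta> \<gamma>\<^sub>0 (- u - rho g n \<eta>) p i * M_diag g n \<eta> i" for p i
  define kr where "kr p i = K_R_diag g n \<eta> \<gamma>\<^sub>0 u p i" for p i
  \<comment> \<open>Everything under the trace of the dual transfer matrix except
    \<open>T_hat\<close>.\<close>
  define Y where "Y = mat_diag D (\<lambda>x. kl (n - p) (dg x)) * T * mat_diag D (\<lambda>x. kr (n - p) (dg x))"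
  have T: "T \<in> carrier_mat D D" "T' \<in> carrier_mat D D"
    unfolding T_def T'_def D_def by (rule T_mono_carrier T_hat_carrier)+
  then have Y: "Y \<in> carrier_mat D D"
    unfolding Y_def by (meson mult_carrier_mat mat_diag_dim)
  have \<Phi>: "\<Phi> x < D" "x < D \<Longrightarrow> \<Phi> (\<Phi> x) = x" for x
    unfolding \<Phi>_def D_def by (rule swap_sites_less[OF n], rule swap_sites_swap_sites[OF n])
  have mult: "reindex D \<Phi> (A * B) = reindex D \<Phi> A * reindex D \<Phi> B"
    if "A \<in> carrier_mat D D" "B \<in> carrier_mat D D" for A B
    using that \<Phi> by (rule reindex_mult)
  have dg: "dg x < 2 * n" for x
    using n by (simp add: dg_def digit_less)
  have rd: "reindex D \<Phi> (mat_diag D (\<lambda>x. f (dg x))) = mat_diag D (\<lambda>x. f (?s (dg x)))" for f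
    unfolding D_def \<Phi>_def dg_def by (rule reindex_mat_diag_digit[OF n])
  \<comment> \<open>The swapped K-matrices absorb the gauge around \<open>T\<close> and leave
    \<open>Y\<close> conjugated by the inverse gauge, which matches the conjugation of
    \<open>T'\<close>.\<close>
  have KT: "mat_diag D (\<lambda>x. kl p (?s (dg x))) * diag_conj D h T * mat_diag D (\<lambda>x. kr p (?s (dg x))) =
      ?f \<cdot>\<^sub>m diag_conj D h' Y"
  proof (rule eq_matI)
    fix x y assume "x < dim_row (?f \<cdot>\<^sub>m diag_conj D h' Y)" "y < dim_col (?f \<cdot>\<^sub>m diag_conj D h' Y)"
    then have xy: "x < D" "y < D" by (simp_all add: diag_conj_def)
    have Yxy: "Y $$ (x, y) = kl (n - p) (dg x) * T $$ (x, y) * kr (n - p) (dg y)"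
      unfolding Y_def using T(1) xy by (rule diag_mult_mat_diag)
    have nz: "h x \<noteq> 0" "h y \<noteq> 0" by (simp_all add: h_def)
    have l: "h x ^ 2 * kl p (?s (dg x)) = f_L g n \<eta> \<gamma>\<^sub>0 u p * kl (n - p) (dg x)"
      unfolding h_def kl_def by (rule K_L_half_swap[OF p \<gamma> dg L])
    have r: "kr p (?s (dg y)) = f_R n \<eta> \<gamma>\<^sub>0 u p * h y ^ 2 * kr (n - p) (dg y)"
      unfolding h_def kr_def by (rule K_R_half_swap[OF p \<gamma> dg R])
    have "(mat_diag D (\<lambda>x. kl p (?s (dg x))) * diag_conj D h T * mat_diag D (\<lambda>x. kr p (?s (dg x)))) $$ (x, y)
      = kl p (?s (dg x)) * (h x * T $$ (x, y) / h y) * kr p (?s (dg y))"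
      using xy by (subst diag_mult_mat_diag) (simp_all add: diag_conj_def)
    \<comment> \<open>Writing \<open>h x\<close> as \<open>h x ^ 2 / h x\<close> makes
      \<open>l\<close> applicable; on the other side \<open>r\<close> supplies
      \<open>h y ^ 2\<close> against the division by \<open>h y\<close>.\<close>
    also have "\<dots> = (h x ^ 2 * kl p (?s (dg x))) / h x * T $$ (x, y) * (kr p (?s (dg y)) / h y)"
      using nz by (simp add: power2_eq_square)
    also have "\<dots> = ?f * (inverse (h x) * Y $$ (x, y) / inverse (h y))"
      unfolding l r Yxy f_dual_def using nz by (simp add: field_simps power2_eq_square)
    also have "\<dots> = (?f \<cdot>\<^sub>m diag_conj D h' Y) $$ (x, y)"
      using xy by (simp add: diag_conj_def h'_def h_def)
    finally show "(mat_diag D (\<lambda>x. kl p (?s (dg x))) * diag_conj D h T * mat_diag D (\<lambda>x. kr p (?s (dg x)))) $$ (x, y)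
      = (?f \<cdot>\<^sub>m diag_conj D h' Y) $$ (x, y)" .
  qed (simp_all add: diag_conj_def)
  have h': "h' x \<noteq> 0" for x by (simp add: h'_def)
  let ?X = "mat_diag D (\<lambda>x. kl p (dg x)) * T * mat_diag D (\<lambda>x. kr p (dg x)) * T'"
  have c: "mat_diag D (\<lambda>x. kl p (dg x)) * T \<in> carrier_mat D D"
    "mat_diag D (\<lambda>x. kl p (dg x)) * T * mat_diag D (\<lambda>x. kr p (dg x)) \<in> carrier_mat D D"
    "?X \<in> carrier_mat D D" "Y * T' \<in> carrier_mat D D"
    using T Y by (meson mult_carrier_mat mat_diag_dim)+
  have "reindex D \<Phi> ?X = mat_diag D (\<lambda>x. kl p (?s (dg x))) * diag_conj D h T *
      mat_diag D (\<lambda>x. kr p (?s (dg x))) * diag_conj D h' T'"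
    using mult[OF c(2) T(2)] mult[OF c(1) mat_diag_dim] mult[OF mat_diag_dim T(1)]
      rd[of "kl p"] rd[of "kr p"]
    by (simp add: T_def T'_def reindex_T_mono reindex_T_hat h_def[abs_def] h'_def[abs_def] dg_def)
  also have "\<dots> = ?f \<cdot>\<^sub>m diag_conj D h' (Y * T')"
    unfolding KT diag_conj_mult[OF Y T(2) h'] by (rule mult_smult_assoc_mat[OF diag_conj_carrier diag_conj_carrier])
  finally have X: "reindex D \<Phi> ?X = ?f \<cdot>\<^sub>m diag_conj D h' (Y * T')" .
  have "reindex ((2 * n) ^ N) (swap_sites n N {..<N}) (transfer g n N \<eta> \<gamma>\<^sub>0 u p) =
      reindex ((2 * n) ^ N) (swap_sites n N {..<N}) (ptrace (2 * n) N ?X)"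
    unfolding transfer_eq kl_def kr_def T_def T'_def dg_def ..
  also have "\<dots> = ptrace (2 * n) N (reindex D \<Phi> ?X)"
    using reindex_ptrace[OF n c(3)[unfolded D_def]] unfolding D_def \<Phi>_def .
  also have "\<dots> = ?f \<cdot>\<^sub>m ptrace (2 * n) N (diag_conj D h' (Y * T'))"
    unfolding X using diag_conj_carrier unfolding D_def by (rule ptrace_smult)
  also have "ptrace (2 * n) N (diag_conj D h' (Y * T')) = ptrace (2 * n) N (Y * T')"
    using ptrace_diag_conj[OF n c(4)[unfolded D_def], of "\<lambda>a. inverse (gauge n u a)"]
    unfolding D_def h'_def[abs_def] dg_def by simp
  also have "\<dots> = transfer g n N \<eta> \<gamma>\<^sub>0 u (n - p)"
    unfolding transfer_eq Y_def kl_def kr_def T_def T'_def dg_def ..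
  finally show ?thesis .
qed

end

theorem proposition2:
  fixes g :: affine_type and n N p :: nat and \<eta> \<gamma>\<^sub>0 :: complex
  assumes "n \<ge> 1" and "N \<ge> 1" and "p \<in> {0..n}" and "\<gamma>\<^sub>0 \<in> {1, - 1}"
  shows "(\<forall>\<^sub>\<approx>u. U_all n N * transfer g n N \<eta> \<gamma>\<^sub>0 u p * U_all n N
            = f_dual g n \<eta> \<gamma>\<^sub>0 u p \<cdot>\<^sub>m transfer g n N \<eta> \<gamma>\<^sub>0 u (n - p))
         \<and> U_all n N * U_all n N = 1\<^sub>m ((2 * n) ^ N)"
proof
  let ?\<phi> = "swap_sites n N {..<N}" and ?D = "(2 * n) ^ N"
  note n = \<open>n \<ge> 1\<close>
  define G where "G = gam g n \<eta> \<gamma>\<^sub>0 p"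
  have G: "G \<noteq> 0" using assms(4) by (auto simp: G_def gam_eq)
  have \<phi>: "?\<phi> x < ?D" "x < ?D \<Longrightarrow> ?\<phi> (?\<phi> x) = x" for x
    by (rule swap_sites_less[OF n], rule swap_sites_swap_sites[OF n])
  have "transfer g n N \<eta> \<gamma>\<^sub>0 u p \<in> carrier_mat ?D ?D" for u
    by (simp add: transfer_def ptrace_def)
  then have conj: "U_all n N * transfer g n N \<eta> \<gamma>\<^sub>0 u p * U_all n N = reindex ?D ?\<phi> (transfer g n N \<eta> \<gamma>\<^sub>0 u p)" for u
    unfolding U_all_eq_perm_mat[OF n] using \<phi> by (rule perm_mat_conj)
  \<comment> \<open>The excluded values are the zeros of denominator and numerator of the right
    factor, then those of the left factor, solved for \<open>exp u\<close>; each excludes only a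
    sparse set of \<open>u\<close>.\<close>
  have "\<forall>\<^sub>\<approx>u. exp u \<noteq> - G" "\<forall>\<^sub>\<approx>u. exp u \<noteq> - 1 / G"
    "\<forall>\<^sub>\<approx>u. exp u \<noteq> - exp (- rho g n \<eta>) / G" "\<forall>\<^sub>\<approx>u. exp u \<noteq> - exp (- rho g n \<eta>) * G"
    by (rule eventually_cosparse_exp_neq)+
  then show "\<forall>\<^sub>\<approx>u. U_all n N * transfer g n N \<eta> \<gamma>\<^sub>0 u p * U_all n N
      = f_dual g n \<eta> \<gamma>\<^sub>0 u p \<cdot>\<^sub>m transfer g n N \<eta> \<gamma>\<^sub>0 u (n - p)"
  proof eventually_elim
    case (elim u)
    have e: "exp (- u - rho g n \<eta>) = exp (- rho g n \<eta>) / exp u"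
      by (metis exp_diff minus_diff_commute)
    have "G + exp u \<noteq> 0" "G * exp u + 1 \<noteq> 0"
      using elim(1,2) G by (auto simp: field_simps add_eq_0_iff)
    moreover have "G + exp (- u - rho g n \<eta>) \<noteq> 0"
    proof
      assume "G + exp (- u - rho g n \<eta>) = 0"
      then have "G * exp u = - exp (- rho g n \<eta>)" unfolding e by (simp add: field_simps add_eq_0_iff)
      with elim(3) G show False by (simp add: field_simps)
    qed
    moreover have "G * exp (- u - rho g n \<eta>) + 1 \<noteq> 0"
    proof
      assume "G * exp (- u - rho g n \<eta>) + 1 = 0"
      then have "exp u = - exp (- rho g n \<eta>) * G" unfolding e by (simp add: field_simps add_eq_0_iff)
      with elim(4) show False by simp
    qed
    ultimately show ?case
      unfolding conj G_def using assms by (intro transfer_dual) simp_all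
  qed
  have "U_all n N * U_all n N = perm_mat ?D (?\<phi> \<circ> ?\<phi>)"
    unfolding U_all_eq_perm_mat[OF n] using \<phi>(1) by (rule perm_mat_mult_perm_mat)
  then show "U_all n N * U_all n N = 1\<^sub>m ?D"
    using \<phi>(2) by (simp add: perm_mat_id)
qed

end
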